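(* Let $F$ be a field of positive characteristic $p$ and let $G$ be a group such that the group algebra $FG$ is modular. The group $V(FG)$ of normalized units of $FG$ is locally nilpotent if and only if $G$ is locally nilpotent and the commutator subgroup $G'$ is a $p$-group.
   Context: $V(FG)$ denotes the group of normalized units of $FG$, i.e. the units $\sum_{g}\alpha_g g$ of $FG$ with augmentation $\sum_g\alpha_g=1$. The group algebra $FG$ over a field $F$ of characteristic $p>0$ is called modular if $G$ contains an element of order $p$. A group is called locally nilpotent if all its finitely generated subgroups are nilpotent. *)

theory Defs
  imports
    "HOL-Algebra.Elementary_Groups"
    "HOL-Algebra.Multiplicative_Group"
    "HOL-Algebra.Ring"
    "HOL-Library.Poly_Mapping"
begin

text \<open>
  The group \<open>G\<close> lives on a carrier set, the field of scalars is a type of class \<open>field\<close>.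
  Formal sums are finitely supported functions on the type of \<open>G\<close> whose support lies in the
  carrier, as in \<open>free_Abelian_group\<close>. The product is bilinear with \<open>g * h = g \<otimes>\<^bsub>G\<^esub> h\<close>
  on basis elements.
\<close>

definition group_algebra ::
    "('g, 'm) monoid_scheme \<Rightarrow> ('g \<Rightarrow>\<^sub>0 'f::field) ring" where
  "group_algebra G =
    \<lparr>carrier = {a. Poly_Mapping.keys a \<subseteq> carrier G},
     mult = (\<lambda>a b. \<Sum>g\<in>Poly_Mapping.keys a. \<Sum>h\<in>Poly_Mapping.keys b.
               Poly_Mapping.single (g \<otimes>\<^bsub>G\<^esub> h)
                 (Poly_Mapping.lookup a g * Poly_Mapping.lookup b h)),
     one = Poly_Mapping.single \<one>\<^bsub>G\<^esub> 1,
     zero = 0,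
     add = (+)\<rparr>"

definition augmentation :: "('g \<Rightarrow>\<^sub>0 'f::field) \<Rightarrow> 'f" where
  "augmentation a = (\<Sum>g\<in>Poly_Mapping.keys a. Poly_Mapping.lookup a g)"

definition normalized_units ::
    "('g, 'm) monoid_scheme \<Rightarrow> ('g \<Rightarrow>\<^sub>0 'f::field) monoid" where
  "normalized_units G =
    (units_of (group_algebra G))
      \<lparr>carrier := {u \<in> Units (group_algebra G). augmentation u = 1}\<rparr>"

text \<open>
  Indexing is shifted by one: \<open>lower_central_series G n\<close> is the term usually called
  \<open>\<gamma>\<^sub>n\<^sub>+\<^sub>1(G)\<close>. The commutator convention is that of \<open>derived\<close>.
\<close>

primrec lower_central_series :: "('a, 'm) monoid_scheme \<Rightarrow> nat \<Rightarrow> 'a set" where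
  "lower_central_series G 0 = carrier G"
| "lower_central_series G (Suc n) =
     generate G (\<Union>x \<in> lower_central_series G n. \<Union>y \<in> carrier G.
       {x \<otimes>\<^bsub>G\<^esub> y \<otimes>\<^bsub>G\<^esub> inv\<^bsub>G\<^esub> x \<otimes>\<^bsub>G\<^esub> inv\<^bsub>G\<^esub> y})"

definition nilpotent_group :: "('a, 'm) monoid_scheme \<Rightarrow> bool" where
  "nilpotent_group G \<longleftrightarrow> group G \<and> (\<exists>n. lower_central_series G n = {\<one>\<^bsub>G\<^esub>})"

definition locally_nilpotent_group :: "('a, 'm) monoid_scheme \<Rightarrow> bool" where
  "locally_nilpotent_group G \<longleftrightarrow>
     group G \<and> (\<forall>S. finite S \<and> S \<subseteq> carrier G \<longrightarrow> nilpotent_group (subgroup_generated G S))"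

definition p_group :: "nat \<Rightarrow> ('a, 'm) monoid_scheme \<Rightarrow> bool" where
  "p_group p G \<longleftrightarrow> group G \<and> (\<forall>x\<in>carrier G. \<exists>k. group.ord G x = p ^ k)"

end

theory Submission
  imports Defs "HOL-Algebra.Ideal" "HOL-Computational_Algebra.Polynomial"
    "HOL-Computational_Algebra.Primes"
begin

text \<open>
  Suppose first that \<open>G\<close> is locally nilpotent and \<open>G'\<close> is a \<open>p\<close>-group. Finitely many normalized units and
  their inverses are supported on a finitely generated, hence nilpotent, subgroup \<open>H\<close>, and it suffices
  that \<open>V(FH)\<close> is nilpotent. In any ring put \<open>L\<^sub>0 = R\<close> and let \<open>L\<^sub>n\<^sub>+\<^sub>1\<close> be the ideal generated by the Lie
  commutators of \<open>L\<^sub>n\<close> with \<open>R\<close>. For units \<open>u\<close>, \<open>v\<close> the identity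
  \<open>u v u\<inverse> v\<inverse> - 1 = ((u - 1) v - v (u - 1)) u\<inverse> v\<inverse>\<close> shows that the lower central series of the unit group
  lies in \<open>1 + L\<^sub>n\<close>, so it is enough that \<open>L\<^sub>n = 0\<close> in \<open>FH\<close> for some \<open>n\<close>
  (\<open>nilpotent_normalized_units\<close>).
  Write \<open>I(N)\<close> for the ideal generated by all \<open>x - 1\<close> with \<open>x \<in> N\<close>. Clearly \<open>L\<^sub>1\<close> lies in \<open>I(H')\<close>.
  Every term of the lower central series of \<open>H\<close> is generated, modulo the next one, by finitely many
  elements \<open>x\<close>. From \<open>H'\<close> on such an \<open>x\<close> has \<open>p\<close>-power order, so \<open>z = x - 1\<close> is nilpotent, and \<open>z\<close> commutes
  with everything modulo the ideal of the next term. If \<open>L\<^sub>a\<close> lies in \<open>z R + K\<close> for such a \<open>z\<close>, then \<open>L\<^sub>k\<^sub>a\<close>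
  lies in \<open>z\<^sup>k R + K\<close>, since a factor \<open>z\<close> can be pulled out of \<open>a\<close> successive commutators
  (\<open>strong_lie_power_subset_step\<close>). Hence the generators can be discarded one at a time until the
  ideal is zero (\<open>strong_lie_power_eventually_zero\<close>).

  Conversely let \<open>V(FG)\<close> be locally nilpotent. Then so is \<open>G\<close>, which embeds into it. In a locally
  nilpotent group the \<open>p\<close>-elements are closed under products, so only the commutator of two elements
  \<open>g\<close>, \<open>h\<close> has to be considered. Together with a given element of order \<open>p\<close> they generate a nilpotent
  group, which therefore has a central element \<open>c\<close> of order \<open>p\<close>. The element
  \<open>N = 1 + c + \<dots> + c\<^sup>p\<^sup>-\<^sup>1\<close> is central with \<open>N\<^sup>2 = 0\<close>, so every \<open>1 + a N\<close> is a normalized unit. Let \<open>T\<close>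
  be conjugation by \<open>g\<close>. Up to inversion, repeated commutators of \<open>1 + h N\<close> with \<open>g\<close> are the elements
  \<open>1 + (T - 1)\<^sup>n (h N)\<close>, and these are eventually \<open>1\<close>. In characteristic \<open>p\<close> the operator \<open>(T - 1)\<^sup>q\<close>
  equals \<open>T\<^sup>q - 1\<close> for every power \<open>q\<close> of \<open>p\<close>; thus \<open>g\<^sup>q\<close> fixes \<open>h N\<close>, which means that \<open>g\<^sup>q\<close> commutes
  with \<open>h\<close> modulo \<open>\<langle>c\<rangle>\<close>, and \<open>g\<^sup>p\<^sup>q\<close> commutes with \<open>h\<close>
  (\<open>central_p_element_prime_power_commutes\<close>). If in a nilpotent group every
  generator has a central power whose exponent is a power of \<open>p\<close>, then the derived subgroup consists
  of \<open>p\<close>-elements (\<open>nilpotent_derived_pow\<close>), and this applies to the commutator of \<open>g\<close> and \<open>h\<close>.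
\<close>

section \<open>Commutators modulo normal subgroups\<close>

abbreviation commutator :: "('a, 'm) monoid_scheme \<Rightarrow> 'a \<Rightarrow> 'a \<Rightarrow> 'a" where
  "commutator G x y \<equiv> x \<otimes>\<^bsub>G\<^esub> y \<otimes>\<^bsub>G\<^esub> inv\<^bsub>G\<^esub> x \<otimes>\<^bsub>G\<^esub> inv\<^bsub>G\<^esub> y"

context group
begin

lemma inv_mult_cancel [simp]:
  assumes "x \<in> carrier G" "y \<in> carrier G"
  shows "inv x \<otimes> (x \<otimes> y) = y" "x \<otimes> (inv x \<otimes> y) = y"
  using assms by (simp_all flip: m_assoc)

lemma commute_inv:
  assumes "x \<in> carrier G" "y \<in> carrier G" "x \<otimes> y = y \<otimes> x"
  shows "x \<otimes> inv y = inv y \<otimes> x"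
proof -
  have "x \<otimes> inv y = inv y \<otimes> (y \<otimes> x) \<otimes> inv y" using assms(1,2) by simp
  also have "\<dots> = inv y \<otimes> x" using assms(1,2) by (simp add: m_assoc flip: assms(3))
  finally show ?thesis .
qed

lemma commute_mult:
  assumes "x \<in> carrier G" "y \<in> carrier G" "z \<in> carrier G" "x \<otimes> y = y \<otimes> x" "x \<otimes> z = z \<otimes> x"
  shows "x \<otimes> (y \<otimes> z) = (y \<otimes> z) \<otimes> x"
proof -
  have "x \<otimes> (y \<otimes> z) = y \<otimes> x \<otimes> z" using assms by (simp flip: m_assoc)
  also have "\<dots> = (y \<otimes> z) \<otimes> x" using assms by (simp add: m_assoc)
  finally show ?thesis .
qed

text \<open>
  If the commutator \<open>w\<close> of \<open>u\<close> and \<open>v\<close> commutes with \<open>v\<close>, then the commutator of \<open>u\<close> and \<open>v\<^sup>k\<close> is \<open>w\<^sup>k\<close>.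
  The equation is written without inverses so that it survives homomorphisms unchanged.
\<close>

lemma commute_past_pow:
  assumes "u \<in> carrier G" "v \<in> carrier G" "w \<in> carrier G"
    and "w \<otimes> v = v \<otimes> w" and uv: "u \<otimes> v = w \<otimes> (v \<otimes> u)"
  shows "u \<otimes> v [^] (k::nat) = w [^] k \<otimes> (v [^] k \<otimes> u)"
proof (induction k)
  case (Suc k)
  have vw: "v [^] k \<otimes> w = w \<otimes> v [^] k"
    using group_commutes_pow[of v w k] assms by simp
  have "u \<otimes> v [^] Suc k = (u \<otimes> v [^] k) \<otimes> v" using assms by (simp add: m_assoc)
  also have "\<dots> = w [^] k \<otimes> (v [^] k \<otimes> (u \<otimes> v))"
    unfolding Suc using assms(1-3) by (simp add: m_assoc)
  also have "\<dots> = w [^] k \<otimes> ((v [^] k \<otimes> w) \<otimes> (v \<otimes> u))"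
    unfolding uv using assms(1-3) by (simp add: m_assoc)
  also have "\<dots> = w [^] Suc k \<otimes> (v [^] Suc k \<otimes> u)"
    unfolding vw using assms(1-3) by (simp add: m_assoc)
  finally show ?case .
qed (use assms in simp)

lemma lcs_subset: "lower_central_series G n \<subseteq> carrier G"
  by (induction n) (auto intro!: generate_incl)

lemma lcs_in_carrier: "x \<in> lower_central_series G n \<Longrightarrow> x \<in> carrier G"
  using lcs_subset by blast

lemma lcs_subgroup: "subgroup (lower_central_series G n) G"
  by (cases n) (auto intro!: generate_is_subgroup subgroup_self dest: lcs_in_carrier)

lemma lcs_commutator:
  "\<lbrakk>x \<in> lower_central_series G n; y \<in> carrier G\<rbrakk> \<Longrightarrow> commutator G x y \<in> lower_central_series G (Suc n)"
  by (auto intro!: generate.incl)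

lemma lcs_Suc_subset: "lower_central_series G (Suc n) \<subseteq> lower_central_series G n"
proof (induction n)
  case 0
  then show ?case using lcs_subset[of 1] by simp
next
  case (Suc n)
  show ?case
    by (subst (1 2) lower_central_series.simps, rule mono_generate) (use Suc in blast)
qed

lemma lcs_antimono: "m \<le> n \<Longrightarrow> lower_central_series G n \<subseteq> lower_central_series G m"
  by (rule lift_Suc_antimono_le[of "lower_central_series G"]) (rule lcs_Suc_subset)

text \<open>
  Conjugating \<open>h\<close> by \<open>x\<close> multiplies it by a commutator that lies even in the next term.
\<close>

lemma lcs_normal: "lower_central_series G n \<lhd> G"
proof (rule normal_invI[OF lcs_subgroup])
  fix x h assume x: "x \<in> carrier G" and h: "h \<in> lower_central_series G n"
  interpret S: subgroup "lower_central_series G n" G by (rule lcs_subgroup)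
  have "commutator G h x \<in> lower_central_series G n"
    using lcs_commutator[OF h x] lcs_Suc_subset by blast
  then have "inv (commutator G h x) \<otimes> h \<in> lower_central_series G n" using h by blast
  also have "inv (commutator G h x) \<otimes> h = x \<otimes> h \<otimes> inv x"
    using x lcs_in_carrier[OF h] by (simp add: inv_mult_group m_assoc)
  finally show "x \<otimes> h \<otimes> inv x \<in> lower_central_series G n" .
qed

lemma lcs_eq_derived: "lower_central_series G (Suc 0) = derived G (carrier G)"
  by (simp add: derived_def)

end

context normal
begin

(* Products in the quotient are kept in the form to which the group laws of the quotient apply. *)
declare mult_FactGroup [simp del] one_FactGroup [simp del]


lemma coset_eq_iff:
  assumes "x \<in> carrier G" "y \<in> carrier G"
  shows "H #> x = H #> y \<longleftrightarrow> x \<otimes> inv y \<in> H"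
proof -
  have "H #> x = H #> y \<longleftrightarrow> x \<in> H #> y"
    using assms rcos_self[OF _ is_subgroup] repr_independence[OF _ _ is_subgroup] by blast
  then show ?thesis using rcos_module[OF is_group] assms by blast
qed

lemma coset_eq_one_iff:
  assumes "x \<in> carrier G" shows "H #> x = H \<longleftrightarrow> x \<in> H"
  using assms coset_join1[OF _ _ is_subgroup] coset_join2[OF _ is_subgroup] by blast

lemma commutator_mem_iff:
  assumes "x \<in> carrier G" "y \<in> carrier G"
  shows "commutator G x y \<in> H \<longleftrightarrow> (H #> x) <#> (H #> y) = (H #> y) <#> (H #> x)"
  using assms by (simp add: rcos_sum coset_eq_iff inv_mult_group m_assoc)

lemma coset_hom: "group_hom G (G Mod H) ((#>) H)"
  using r_coset_hom_Mod factorgroup_is_group is_group by (simp add: group_hom_def group_hom_axioms_def)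

text \<open>
  This is the preimage of a centralizer in the quotient by \<open>H\<close>.
\<close>

lemma subgroup_commuting_mod:
  assumes "x \<in> carrier G"
  shows "subgroup {y \<in> carrier G. commutator G x y \<in> H} G"
proof -
  interpret Q: group "G Mod H" by (rule factorgroup_is_group)
  interpret h: group_hom G "G Mod H" "(#>) H" by (rule coset_hom)
  let ?c = "\<lambda>z. H #> z"
  have eq: "commutator G x y \<in> H \<longleftrightarrow> ?c x \<otimes>\<^bsub>G Mod H\<^esub> ?c y = ?c y \<otimes>\<^bsub>G Mod H\<^esub> ?c x"
    if "y \<in> carrier G" for y
    using commutator_mem_iff[OF assms that] by (simp add: FactGroup_def)
  show ?thesis
  proof (rule subgroupI, goal_cases)
    case 1 then show ?case by auto
  next
    case 2 then show ?case using assms by (auto simp: m_assoc intro!: exI[of _ \<one>])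
  next
    case (3 y)
    then have y: "y \<in> carrier G" "?c x \<otimes>\<^bsub>G Mod H\<^esub> ?c y = ?c y \<otimes>\<^bsub>G Mod H\<^esub> ?c x" using eq by auto
    have "commutator G x (inv y) \<in> H"
      unfolding eq[OF inv_closed[OF y(1)]] h.hom_inv[OF y(1)]
      using y(2) by (intro Q.commute_inv h.hom_closed assms y(1))
    then show ?case using y(1) by simp  next
    case (4 y z)
    then have y: "y \<in> carrier G" "?c x \<otimes>\<^bsub>G Mod H\<^esub> ?c y = ?c y \<otimes>\<^bsub>G Mod H\<^esub> ?c x"
      and z: "z \<in> carrier G" "?c x \<otimes>\<^bsub>G Mod H\<^esub> ?c z = ?c z \<otimes>\<^bsub>G Mod H\<^esub> ?c x" using eq by auto
    have "commutator G x (y \<otimes> z) \<in> H"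
      unfolding eq[OF m_closed[OF y(1) z(1)]] h.hom_mult[OF y(1) z(1)]
      using y(2) z(2) by (intro Q.commute_mult h.hom_closed assms y(1) z(1))
    then show ?case using y(1) z(1) by simp
  qed
qed

lemma commutator_mem_commute:
  assumes "x \<in> carrier G" "y \<in> carrier G"
  shows "commutator G x y \<in> H \<longleftrightarrow> commutator G y x \<in> H"
  using assms commutator_mem_iff by auto

lemma subgroup_central_mod: "subgroup {x \<in> carrier G. \<forall>y\<in>carrier G. commutator G x y \<in> H} G"
proof -
  have "{x \<in> carrier G. \<forall>y\<in>carrier G. commutator G x y \<in> H} = (\<Inter>y\<in>carrier G. {x \<in> carrier G. commutator G y x \<in> H})"
    using commutator_mem_commute by auto
  then show ?thesis using subgroup_commuting_mod
    by (auto intro!: subgroups_Inter)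
qed

text \<open>
  Modulo \<open>H\<close> the commutator of \<open>x\<close> and \<open>s\<close> commutes with \<open>s\<close>, so there \<open>[x, s]\<^sup>q = [x, s\<^sup>q]\<close>. This is how the
  finiteness of a power of \<open>s\<close>, or its centrality, passes to commutators.
\<close>

lemma commutator_pow_mem:
  assumes x: "x \<in> carrier G" and s: "s \<in> carrier G"
    and "commutator G (commutator G x s) s \<in> H" and "commutator G x (s [^] (q::nat)) \<in> H"
  shows "commutator G x s [^] q \<in> H"
proof -
  interpret Q: group "G Mod H" by (rule factorgroup_is_group)
  interpret h: group_hom G "G Mod H" "(#>) H" by (rule coset_hom)
  let ?c = "\<lambda>z. H #> z"
  let ?w = "commutator G x s"
  have w: "?w \<in> carrier G" using x s by simp
  have "?c ?w \<otimes>\<^bsub>G Mod H\<^esub> ?c s = ?c s \<otimes>\<^bsub>G Mod H\<^esub> ?c ?w"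
    using assms(3) commutator_mem_iff[OF w s] by (simp only: mult_FactGroup)
  moreover have "?c x \<otimes>\<^bsub>G Mod H\<^esub> ?c s = ?c ?w \<otimes>\<^bsub>G Mod H\<^esub> (?c s \<otimes>\<^bsub>G Mod H\<^esub> ?c x)"
  proof -
    have "x \<otimes> s = ?w \<otimes> (s \<otimes> x)" using x s by (simp add: m_assoc)
    then show ?thesis using x s w by (metis h.hom_mult m_closed)
  qed
  ultimately have "?c x \<otimes>\<^bsub>G Mod H\<^esub> ?c s [^]\<^bsub>G Mod H\<^esub> q
      = ?c ?w [^]\<^bsub>G Mod H\<^esub> q \<otimes>\<^bsub>G Mod H\<^esub> (?c s [^]\<^bsub>G Mod H\<^esub> q \<otimes>\<^bsub>G Mod H\<^esub> ?c x)"
    by (intro Q.commute_past_pow h.hom_closed x s w)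
  then have "?c x \<otimes>\<^bsub>G Mod H\<^esub> ?c (s [^] q)
      = ?c (?w [^] q) \<otimes>\<^bsub>G Mod H\<^esub> (?c (s [^] q) \<otimes>\<^bsub>G Mod H\<^esub> ?c x)"
    by (simp only: h.hom_nat_pow[OF s] h.hom_nat_pow[OF w])
  moreover have "?c x \<otimes>\<^bsub>G Mod H\<^esub> ?c (s [^] q) = ?c (s [^] q) \<otimes>\<^bsub>G Mod H\<^esub> ?c x"
    using assms(4) commutator_mem_iff[of x "s [^] q"] x s by (simp only: mult_FactGroup nat_pow_closed)
  ultimately have "?c (?w [^] q) = \<one>\<^bsub>G Mod H\<^esub>"
    using Q.r_cancel_one'[of "?c (s [^] q) \<otimes>\<^bsub>G Mod H\<^esub> ?c x" "?c (?w [^] q)"]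
      h.hom_closed[OF x] h.hom_closed[OF nat_pow_closed[OF s]] h.hom_closed[OF nat_pow_closed[OF w]]
    by (metis Q.m_closed)
  then show ?thesis using coset_eq_one_iff[OF nat_pow_closed[OF w]] by (simp only: one_FactGroup)
qed

text \<open>
  The image of \<open>K\<close> in the quotient by \<open>H\<close> is abelian, and in an abelian group the \<open>p\<close>-elements form a
  subgroup.
\<close>

lemma subgroup_pow_mem:
  assumes K: "subgroup K G" and comm: "\<And>x y. x \<in> K \<Longrightarrow> y \<in> K \<Longrightarrow> commutator G x y \<in> H"
  shows "subgroup {x \<in> K. \<exists>m. x [^] (p ^ m :: nat) \<in> H} G"
proof -
  interpret K: subgroup K G by fact
  interpret Q: group "G Mod H" by (rule factorgroup_is_group)
  interpret h: group_hom G "G Mod H" "(#>) H" by (rule coset_hom)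
  show ?thesis
  proof (rule subgroupI, goal_cases)
    case 1 then show ?case by auto
  next
    case 2 then show ?case by (auto intro!: exI[of _ \<one>])
  next
    case (3 x)
    then obtain m where m: "x \<in> K" "x [^] (p ^ m) \<in> H" by blast
    then have "inv x [^] (p ^ m) = inv (x [^] (p ^ m))" by (simp add: nat_pow_inv)
    then have "inv x [^] (p ^ m) \<in> H" using m by simp
    then show ?case using m by auto
  next
    case (4 x y)
    then obtain m n where m: "x \<in> K" "x [^] (p ^ m) \<in> H" and n: "y \<in> K" "y [^] (p ^ n) \<in> H" by blast
    have pw: "z [^] (p ^ (i + j)) \<in> H" if "z \<in> K" "z [^] (p ^ i) \<in> H" for z i j
    proof -
      have "(z [^] (p ^ i)) [^] k \<in> H" for k :: nat
        using that by (induction k) auto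
      then show ?thesis using that by (simp add: nat_pow_pow power_add)
    qed
    have "x [^] (p ^ (m + n)) \<in> H" using pw[OF m] .
    moreover have "y [^] (p ^ (m + n)) \<in> H" using pw[OF n, of m] by (simp only: add.commute)
    ultimately have xH: "H #> (x [^] (p ^ (m + n))) = H" and yH: "H #> (y [^] (p ^ (m + n))) = H"
      using coset_eq_one_iff m n by auto
    have cc: "(H #> x) \<otimes>\<^bsub>G Mod H\<^esub> (H #> y) = (H #> y) \<otimes>\<^bsub>G Mod H\<^esub> (H #> x)"
      using commutator_mem_iff[of x y] comm[of x y] m n by (simp only: mult_FactGroup K.mem_carrier)
    have "H #> ((x \<otimes> y) [^] (p ^ (m + n))) = ((H #> x) \<otimes>\<^bsub>G Mod H\<^esub> (H #> y)) [^]\<^bsub>G Mod H\<^esub> (p ^ (m + n))"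
      using m n h.hom_nat_pow[of "x \<otimes> y"] by simp
    also have "\<dots> = (H #> x) [^]\<^bsub>G Mod H\<^esub> (p ^ (m + n)) \<otimes>\<^bsub>G Mod H\<^esub> (H #> y) [^]\<^bsub>G Mod H\<^esub> (p ^ (m + n))"
      using m n by (intro Q.pow_mult_distrib cc h.hom_closed) auto
    also have "\<dots> = \<one>\<^bsub>G Mod H\<^esub> \<otimes>\<^bsub>G Mod H\<^esub> \<one>\<^bsub>G Mod H\<^esub>"
      using m n xH yH by (simp only: one_FactGroup flip: h.hom_nat_pow[OF K.mem_carrier])
    also have "\<dots> = H" by (simp only: Q.r_one Q.one_closed) (simp only: one_FactGroup)
    finally have "(x \<otimes> y) [^] (p ^ (m + n)) \<in> H" using coset_eq_one_iff m n by auto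
    then show ?case using m n by blast
  qed
qed

end

section \<open>Lower central series and elements of prime power order\<close>

(* Keeps the terms of the series as atoms, which is how the rules about them are stated. *)
declare lower_central_series.simps(2) [simp del]

context group
begin

text \<open>
  Modulo the term after next, the commutator is bilinear on a term of the series times \<open>G\<close>; generators
  of the factors therefore yield generators of the next factor. Instead of expanding products, the
  proof observes that the subgroup \<open>M\<close> on the right is normal and that the elements which commute with
  a given set modulo \<open>M\<close> form a subgroup, in each of the two arguments.
\<close>

lemma lcs_generated_step:
  assumes S: "S \<subseteq> carrier G" "carrier G = generate G S"
    and X: "X \<subseteq> lower_central_series G n"
    and gen: "lower_central_series G n = generate G (X \<union> lower_central_series G (Suc n))"
  shows "lower_central_series G (Suc n) =
    generate G ((\<Union>x\<in>X. commutator G x ` S) \<union> lower_central_series G (Suc (Suc n)))"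
proof -
  let ?g = "lower_central_series G"
  define Y where "Y = (\<Union>x\<in>X. commutator G x ` S) \<union> ?g (Suc (Suc n))"
  define M where "M = generate G Y"
  have XG: "X \<subseteq> carrier G" using X lcs_subset by blast
  have Y: "Y \<subseteq> ?g (Suc n)"
    unfolding Y_def using X S(1) lcs_commutator lcs_Suc_subset by blast
  have YG: "Y \<subseteq> carrier G" using Y lcs_subset by blast
  have M1: "M \<subseteq> ?g (Suc n)"
    unfolding M_def by (rule generate_subgroup_incl[OF Y lcs_subgroup])
  have M2: "?g (Suc (Suc n)) \<subseteq> M" unfolding M_def Y_def by (auto intro: generate.incl)
  have Msub: "subgroup M G" unfolding M_def by (rule generate_is_subgroup[OF YG])
  \<comment> \<open>Commutators of elements of \<open>M\<close> lie in the term after next, which is part of \<open>M\<close>.\<close>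
  have "M \<lhd> G"
  proof (rule normal_invI[OF Msub])
    fix x h assume x: "x \<in> carrier G" and h: "h \<in> M"
    interpret S: subgroup M G by (rule Msub)
    have "commutator G h x \<in> M" using lcs_commutator[of h "Suc n" x] M1 M2 h x by blast
    then have "inv (commutator G h x) \<otimes> h \<in> M" using h by blast
    also have "inv (commutator G h x) \<otimes> h = x \<otimes> h \<otimes> inv x"
      using x h by (simp add: inv_mult_group m_assoc)
    finally show "x \<otimes> h \<otimes> inv x \<in> M" .
  qed
  then interpret M: normal M G .
  have "carrier G \<subseteq> {k \<in> carrier G. commutator G x k \<in> M}" if x: "x \<in> X" for x
  proof -
    have "S \<subseteq> {k \<in> carrier G. commutator G x k \<in> M}"
      using S(1) x unfolding M_def Y_def by (auto intro!: generate.incl)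
    moreover have "subgroup {k \<in> carrier G. commutator G x k \<in> M} G"
      using M.subgroup_commuting_mod x XG by blast
    ultimately have "generate G S \<subseteq> {k \<in> carrier G. commutator G x k \<in> M}"
      by (rule generate_subgroup_incl)
    then show ?thesis by (simp only: S(2)[symmetric])
  qed
  then have 1: "X \<subseteq> {x \<in> carrier G. \<forall>k\<in>carrier G. commutator G x k \<in> M}" using XG by blast
  have 2: "?g (Suc n) \<subseteq> {x \<in> carrier G. \<forall>k\<in>carrier G. commutator G x k \<in> M}"
    using lcs_commutator[of _ "Suc n"] M2 lcs_subset by blast
  have "?g n \<subseteq> {x \<in> carrier G. \<forall>k\<in>carrier G. commutator G x k \<in> M}"
    by (subst gen, rule generate_subgroup_incl[OF _ M.subgroup_central_mod]) (use 1 2 in blast)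
  then have "?g (Suc n) \<subseteq> M"
    by (subst lower_central_series.simps, intro generate_subgroup_incl[OF _ Msub]) blast
  then show ?thesis using M1 unfolding M_def Y_def by blast
qed

text \<open>
  A term of the series below the first is generated, modulo the next, by commutators \<open>[x, s]\<close> with
  \<open>s \<in> S\<close>, and \<open>[x, s]\<^sup>q\<close> is trivial modulo the next term as soon as \<open>s\<^sup>q\<close> is central. So every element
  of the derived subgroup can be moved down the series by raising it to powers of \<open>p\<close>.
\<close>

lemma nilpotent_derived_pow:
  assumes nil: "lower_central_series G c = {\<one>}"
    and S: "S \<subseteq> carrier G" "carrier G = generate G S"
    and central: "\<And>s. s \<in> S \<Longrightarrow> \<exists>m. \<forall>x\<in>carrier G. commutator G x (s [^] (p ^ m :: nat)) = \<one>"
    and x: "x \<in> lower_central_series G (Suc 0)"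
  shows "\<exists>m. x [^] (p ^ m :: nat) = \<one>"
proof -
  let ?g = "lower_central_series G"
  have step: "\<exists>m. y [^] (p ^ m) \<in> ?g (Suc (Suc n))" if y: "y \<in> ?g (Suc n)" for n y
  proof -
    interpret M: normal "?g (Suc (Suc n))" G by (rule lcs_normal)
    define P where "P = {y \<in> ?g (Suc n). \<exists>m. y [^] (p ^ m) \<in> ?g (Suc (Suc n))}"
    have P: "subgroup P G" unfolding P_def
      by (rule M.subgroup_pow_mem[OF lcs_subgroup], rule lcs_commutator, assumption, erule lcs_in_carrier)
    have "commutator G x s \<in> P" if x: "x \<in> ?g n" and s: "s \<in> S" for x s
    proof -
      have xs: "x \<in> carrier G" "s \<in> carrier G" using x s S lcs_subset by blast+
      obtain m where m: "\<forall>x\<in>carrier G. commutator G x (s [^] (p ^ m)) = \<one>" using central s by blast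
      have 1: "commutator G x s \<in> ?g (Suc n)" by (rule lcs_commutator[OF x xs(2)])
      have "commutator G x s [^] (p ^ m) \<in> ?g (Suc (Suc n))"
        using m xs by (intro M.commutator_pow_mem xs lcs_commutator[OF 1]) simp_all
      then show ?thesis using 1 unfolding P_def by blast
    qed
    moreover have "?g (Suc (Suc n)) \<subseteq> P"
    proof
      fix y assume y: "y \<in> ?g (Suc (Suc n))"
      then have "y [^] (p ^ 0) \<in> ?g (Suc (Suc n))" using lcs_in_carrier[OF y] by simp
      then show "y \<in> P" using y lcs_Suc_subset unfolding P_def by blast
    qed
    ultimately have "(\<Union>x\<in>?g n. commutator G x ` S) \<union> ?g (Suc (Suc n)) \<subseteq> P" by blast
    then have "generate G ((\<Union>x\<in>?g n. commutator G x ` S) \<union> ?g (Suc (Suc n))) \<subseteq> P"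
      by (rule generate_subgroup_incl[OF _ P])
    moreover have "?g n = generate G (?g n \<union> ?g (Suc n))"
      using lcs_Suc_subset[of n] generateI[OF lcs_subgroup] by (simp only: Un_absorb2)
    ultimately have "?g (Suc n) \<subseteq> P"
      using lcs_generated_step[OF S order_refl] by blast
    then show ?thesis using y unfolding P_def by blast
  qed
  have "\<exists>m. x [^] (p ^ m) \<in> ?g (Suc n)" for n
  proof (induction n)
    case 0
    have "x [^] (p ^ 0) \<in> ?g (Suc 0)" using x lcs_in_carrier[OF x] by simp
    then show ?case by blast
  next
    case (Suc n)
    then obtain m where "x [^] (p ^ m) \<in> ?g (Suc n)" by blast
    from step[OF this] obtain k where "(x [^] (p ^ m)) [^] (p ^ k) \<in> ?g (Suc (Suc n))" by blast
    then have "x [^] (p ^ (m + k)) \<in> ?g (Suc (Suc n))"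
      using lcs_in_carrier[OF x] by (simp add: nat_pow_pow power_add)
    then show ?case by blast
  qed
  from this[of c] nil lcs_Suc_subset[of c] show ?thesis by blast
qed

text \<open>
  The abelianization is generated by \<open>p\<close>-elements, so some power of each element lies in the derived
  subgroup. There \<open>nilpotent_derived_pow\<close> applies, because trivial powers are central.
\<close>

lemma nilpotent_pow:
  assumes nil: "lower_central_series G c = {\<one>}"
    and S: "S \<subseteq> carrier G" "carrier G = generate G S"
    and pS: "\<And>s. s \<in> S \<Longrightarrow> \<exists>m. s [^] (p ^ m :: nat) = \<one>"
    and x: "x \<in> carrier G"
  shows "\<exists>m. x [^] (p ^ m :: nat) = \<one>"
proof -
  let ?g = "lower_central_series G"
  interpret M: normal "?g (Suc 0)" G by (rule lcs_normal)
  have "subgroup {x \<in> carrier G. \<exists>m. x [^] (p ^ m) \<in> ?g (Suc 0)} G"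
    by (rule M.subgroup_pow_mem[OF subgroup_self lcs_commutator]) simp_all
  moreover have "S \<subseteq> {x \<in> carrier G. \<exists>m. x [^] (p ^ m) \<in> ?g (Suc 0)}"
  proof
    fix s assume s: "s \<in> S"
    then obtain m where "s [^] (p ^ m) = \<one>" using pS by blast
    then have "s [^] (p ^ m) \<in> ?g (Suc 0)" using M.one_closed by (simp only:)
    then show "s \<in> {x \<in> carrier G. \<exists>m. x [^] (p ^ m) \<in> ?g (Suc 0)}" using s S(1) by blast
  qed
  ultimately have "x \<in> {x \<in> carrier G. \<exists>m. x [^] (p ^ m) \<in> ?g (Suc 0)}"
    using x S generate_subgroup_incl by blast
  then obtain m where m: "x [^] (p ^ m) \<in> ?g (Suc 0)" by blast
  have "\<exists>m. \<forall>x\<in>carrier G. commutator G x (s [^] (p ^ m)) = \<one>" if s: "s \<in> S" for s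
  proof -
    obtain m where "s [^] (p ^ m) = \<one>" using pS[OF s] by blast
    then have "\<forall>x\<in>carrier G. commutator G x (s [^] (p ^ m)) = \<one>" by simp
    then show ?thesis by blast
  qed
  from nilpotent_derived_pow[OF nil S this m] obtain k where "(x [^] (p ^ m)) [^] (p ^ k) = \<one>" by blast
  then have "x [^] (p ^ (m + k)) = \<one>" using x by (simp add: nat_pow_pow power_add)
  then show ?thesis by blast
qed

end

lemma lcs_hom_image:
  assumes "group_hom K M f" and "x \<in> lower_central_series K n"
  shows "f x \<in> lower_central_series M n"
proof -
  interpret group_hom K M f by fact
  show ?thesis using assms(2)
  proof (induction n arbitrary: x)
    case 0
    then show ?case by simp
  next
    case (Suc n)
    let ?U = "\<lambda>G. \<Union>x \<in> lower_central_series G n. \<Union>y \<in> carrier G. {commutator G x y}"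
    have "f ` generate K (?U K) = generate M (f ` ?U K)"
      by (rule generate_img[symmetric]) (auto dest: G.lcs_in_carrier)
    also have "\<dots> \<subseteq> generate M (?U M)"
    proof (rule H.mono_generate, clarify)
      fix x y assume "x \<in> lower_central_series K n" "y \<in> carrier K"
      moreover from this have "f (commutator K x y) = commutator M (f x) (f y)"
        using G.lcs_in_carrier by simp
      ultimately show "f (commutator K x y) \<in> ?U M" using Suc.IH hom_closed by blast
    qed
    finally show ?case using Suc.prems by (auto simp: lower_central_series.simps)
  qed
qed

text \<open>
  Subgroups of nilpotent groups are nilpotent; stating this for injective homomorphisms avoids
  comparing the operations of a group with those of structures built from its subgroups.
\<close>

lemma nilpotent_group_inj_hom:
  assumes "group_hom K M f" "inj_on f (carrier K)" "nilpotent_group M"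
  shows "nilpotent_group K"
proof -
  interpret group_hom K M f by fact
  obtain n where n: "lower_central_series M n = {\<one>\<^bsub>M\<^esub>}" using assms(3) unfolding nilpotent_group_def by blast
  have "lower_central_series K n \<subseteq> {\<one>\<^bsub>K\<^esub>}"
  proof
    fix x assume x: "x \<in> lower_central_series K n"
    then have "f x = f \<one>\<^bsub>K\<^esub>" using lcs_hom_image[OF assms(1) x] n by simp
    then show "x \<in> {\<one>\<^bsub>K\<^esub>}" using inj_onD[OF assms(2) _ G.lcs_in_carrier[OF x] G.one_closed] by blast
  qed
  moreover have "\<one>\<^bsub>K\<^esub> \<in> lower_central_series K n" by (rule subgroup.one_closed[OF G.lcs_subgroup])
  ultimately show ?thesis using G.is_group unfolding nilpotent_group_def by blast
qed

lemma locally_nilpotent_group_inj_hom: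
  assumes h: "group_hom K M f" and inj: "inj_on f (carrier K)" and M: "locally_nilpotent_group M"
  shows "locally_nilpotent_group K"
  unfolding locally_nilpotent_group_def
proof (intro conjI allI impI)
  interpret group_hom K M f by fact
  show "group K" by (rule G.is_group)
  fix S assume S: "finite S \<and> S \<subseteq> carrier K"
  have sub: "carrier (subgroup_generated K S) \<subseteq> carrier K" by (rule G.carrier_subgroup_generated_subset)
  have "f \<in> hom (subgroup_generated K S) (subgroup_generated M (f ` S))"
    using S by (intro hom_between_subgroups) auto
  then have "group_hom (subgroup_generated K S) (subgroup_generated M (f ` S)) f"
    by (simp add: group_hom_def group_hom_axioms_def)
  moreover have "inj_on f (carrier (subgroup_generated K S))" using inj sub inj_on_subset by blast
  moreover have "nilpotent_group (subgroup_generated M (f ` S))"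
    using M S hom_closed unfolding locally_nilpotent_group_def
    by (metis finite_imageI image_subset_iff subset_iff)
  ultimately show "nilpotent_group (subgroup_generated K S)" by (rule nilpotent_group_inj_hom)
qed

lemma (in group) generate_subgroup_generated:
  assumes "S \<subseteq> carrier G"
  shows "S \<subseteq> carrier (subgroup_generated G S)"
    "carrier (subgroup_generated G S) = generate (subgroup_generated G S) S"
proof -
  show "S \<subseteq> carrier (subgroup_generated G S)"
    using assms by (simp add: subgroup_generated_subset_carrier_subset)
  then have "generate (subgroup_generated G S) S = carrier (subgroup_generated (subgroup_generated G S) S)"
    using carrier_subgroup_generated[of "subgroup_generated G S" S] by (simp only: Int_absorb1)
  then show "carrier (subgroup_generated G S) = generate (subgroup_generated G S) S" by simp
qed

text \<open>
  In a locally nilpotent group the \<open>p\<close>-elements are closed under products: look inside the nilpotent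
  subgroup generated by the two factors.
\<close>

lemma (in group) locally_nilpotent_pow_mult:
  assumes "locally_nilpotent_group G"
    and x: "x \<in> carrier G" "x [^] (p ^ i :: nat) = \<one>"
    and y: "y \<in> carrier G" "y [^] (p ^ j :: nat) = \<one>"
  shows "\<exists>m. (x \<otimes> y) [^] (p ^ m :: nat) = \<one>"
proof -
  let ?K = "subgroup_generated G {x, y}"
  interpret K: group ?K by simp
  have S: "{x, y} \<subseteq> carrier ?K" "carrier ?K = generate ?K {x, y}"
    using generate_subgroup_generated[of "{x, y}"] x y by auto
  obtain c where c: "lower_central_series ?K c = {\<one>\<^bsub>?K\<^esub>}"
    using assms(1) x y unfolding locally_nilpotent_group_def nilpotent_group_def
    by (metis finite.emptyI finite.insertI insert_subset empty_subsetI)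
  have "\<exists>m. s [^]\<^bsub>?K\<^esub> (p ^ m) = \<one>\<^bsub>?K\<^esub>" if "s \<in> {x, y}" for s
    using that x y by (auto simp: pow_subgroup_generated)
  from K.nilpotent_pow[OF c S this, of "x \<otimes> y"] show ?thesis
    using S(1) K.m_closed[of x y] by (simp add: pow_subgroup_generated)
qed

section \<open>The group algebra as a ring\<close>

lemma group_algebra_mult_superset:
  assumes "finite A" "Poly_Mapping.keys a \<subseteq> A" "finite B" "Poly_Mapping.keys b \<subseteq> B"
  shows "a \<otimes>\<^bsub>group_algebra G\<^esub> b = (\<Sum>g\<in>A. \<Sum>h\<in>B. Poly_Mapping.single (g \<otimes>\<^bsub>G\<^esub> h)
    (Poly_Mapping.lookup a g * Poly_Mapping.lookup b h))"
proof -
  have "a \<otimes>\<^bsub>group_algebra G\<^esub> b = (\<Sum>g\<in>Poly_Mapping.keys a. \<Sum>h\<in>B. Poly_Mapping.single (g \<otimes>\<^bsub>G\<^esub> h)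
    (Poly_Mapping.lookup a g * Poly_Mapping.lookup b h))"
    unfolding group_algebra_def using assms
    by (simp, intro sum.cong refl sum.mono_neutral_left) (auto simp: in_keys_iff)
  also have "\<dots> = (\<Sum>g\<in>A. \<Sum>h\<in>B. Poly_Mapping.single (g \<otimes>\<^bsub>G\<^esub> h)
    (Poly_Mapping.lookup a g * Poly_Mapping.lookup b h))"
    using assms by (intro sum.mono_neutral_left) (auto simp: in_keys_iff)
  finally show ?thesis .
qed

lemma group_algebra_simps [simp]:
  "carrier (group_algebra G) = {a. Poly_Mapping.keys a \<subseteq> carrier G}"
  "\<one>\<^bsub>group_algebra G\<^esub> = Poly_Mapping.single \<one>\<^bsub>G\<^esub> 1"
  "\<zero>\<^bsub>group_algebra G\<^esub> = 0"
  "a \<oplus>\<^bsub>group_algebra G\<^esub> b = a + b"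
  by (simp_all add: group_algebra_def)

lemma group_algebra_distrib:
  "(a + b) \<otimes>\<^bsub>group_algebra G\<^esub> c = a \<otimes>\<^bsub>group_algebra G\<^esub> c + b \<otimes>\<^bsub>group_algebra G\<^esub> c"
  "c \<otimes>\<^bsub>group_algebra G\<^esub> (a + b) = c \<otimes>\<^bsub>group_algebra G\<^esub> a + c \<otimes>\<^bsub>group_algebra G\<^esub> b"
proof -
  let ?A = "Poly_Mapping.keys a \<union> Poly_Mapping.keys b" and ?C = "Poly_Mapping.keys c"
  have ks: "Poly_Mapping.keys (a + b) \<subseteq> ?A" by (rule keys_add)
  show "(a + b) \<otimes>\<^bsub>group_algebra G\<^esub> c = a \<otimes>\<^bsub>group_algebra G\<^esub> c + b \<otimes>\<^bsub>group_algebra G\<^esub> c"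
    using group_algebra_mult_superset[of ?A "a + b" ?C c G] group_algebra_mult_superset[of ?A a ?C c G]
      group_algebra_mult_superset[of ?A b ?C c G] ks
    by (simp add: lookup_add distrib_right single_add sum.distrib)
  show "c \<otimes>\<^bsub>group_algebra G\<^esub> (a + b) = c \<otimes>\<^bsub>group_algebra G\<^esub> a + c \<otimes>\<^bsub>group_algebra G\<^esub> b"
    using group_algebra_mult_superset[of ?C c ?A "a + b" G] group_algebra_mult_superset[of ?C c ?A a G]
      group_algebra_mult_superset[of ?C c ?A b G] ks
    by (simp add: lookup_add distrib_left single_add sum.distrib)
qed

lemma group_algebra_mult_single [simp]:
  "Poly_Mapping.single g x \<otimes>\<^bsub>group_algebra G\<^esub> Poly_Mapping.single h y
     = Poly_Mapping.single (g \<otimes>\<^bsub>G\<^esub> h) (x * y)"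
  using group_algebra_mult_superset[of "{g}" "Poly_Mapping.single g x" "{h}" "Poly_Mapping.single h y" G]
  by simp

lemma group_algebra_mult_zero [simp]:
  "0 \<otimes>\<^bsub>group_algebra G\<^esub> a = 0" "a \<otimes>\<^bsub>group_algebra G\<^esub> 0 = 0"
  by (simp_all add: group_algebra_def)

lemma keys_add_subset:
  "Poly_Mapping.keys a \<subseteq> C \<Longrightarrow> Poly_Mapping.keys b \<subseteq> C \<Longrightarrow> Poly_Mapping.keys (a + b) \<subseteq> C"
  by (rule order_trans[OF keys_add]) simp

text \<open>
  Identities that are additive in each argument need to be checked only on multiples of group
  elements. The restriction to supports inside \<open>C\<close> is what makes the group laws available there.
\<close>

lemma keys_subset_induct [consumes 1, case_names zero single add]:
  fixes a :: "'a \<Rightarrow>\<^sub>0 'b::comm_monoid_add"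
  assumes "Poly_Mapping.keys a \<subseteq> C" "P 0"
    and single: "\<And>g x. g \<in> C \<Longrightarrow> P (Poly_Mapping.single g x)"
    and add: "\<And>a b. Poly_Mapping.keys a \<subseteq> C \<Longrightarrow> Poly_Mapping.keys b \<subseteq> C \<Longrightarrow> P a \<Longrightarrow> P b \<Longrightarrow> P (a + b)"
  shows "P a"
proof -
  let ?s = "\<lambda>A. \<Sum>g\<in>A. Poly_Mapping.single g (Poly_Mapping.lookup a g)"
  have "Poly_Mapping.keys (?s A) \<subseteq> C \<and> P (?s A)" if "finite A" "A \<subseteq> C" for A
    using that
  proof (induction A)
    case empty
    then show ?case using assms(2) by simp
  next
    case (insert g A)
    have k: "Poly_Mapping.keys (Poly_Mapping.single g (Poly_Mapping.lookup a g)) \<subseteq> C"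
      using insert.prems by simp
    have "Poly_Mapping.keys (Poly_Mapping.single g (Poly_Mapping.lookup a g) + ?s A) \<subseteq> C"
      using k insert by (intro keys_add_subset) auto
    then show ?case using insert add[OF k] single by simp
  qed
  moreover have "?s (Poly_Mapping.keys a) = a"
    by (rule poly_mapping_eqI) (simp add: lookup_sum lookup_single when_def in_keys_iff)
  ultimately show ?thesis using assms(1) by (metis finite_keys)
qed

lemma augmentation_superset:
  assumes "finite A" "Poly_Mapping.keys a \<subseteq> A"
  shows "augmentation a = (\<Sum>g\<in>A. Poly_Mapping.lookup a g)"
  unfolding augmentation_def using assms by (intro sum.mono_neutral_left) (auto simp: in_keys_iff)

lemma augmentation_add: "augmentation (a + b) = augmentation a + augmentation b"
proof -
  let ?A = "Poly_Mapping.keys a \<union> Poly_Mapping.keys b"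
  show ?thesis
    using augmentation_superset[of ?A "a + b"] augmentation_superset[of ?A a]
      augmentation_superset[of ?A b] keys_add[of a b]
    by (simp add: lookup_add sum.distrib)
qed

lemma augmentation_single [simp]: "augmentation (Poly_Mapping.single g x) = x"
  using augmentation_superset[of "{g}" "Poly_Mapping.single g x"] by simp

lemma augmentation_mult:
  "augmentation (a \<otimes>\<^bsub>group_algebra G\<^esub> b) = augmentation a * augmentation b"
proof -
  have z: "augmentation 0 = 0" by (simp add: augmentation_def)
  have "Poly_Mapping.keys a \<subseteq> UNIV" "Poly_Mapping.keys b \<subseteq> UNIV" by auto
  then show ?thesis
  proof (induction a rule: keys_subset_induct)
    case (single g x)
    from single(2) show ?case
      by (induction b rule: keys_subset_induct)
        (auto simp: z group_algebra_distrib augmentation_add distrib_left)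
  qed (auto simp: z group_algebra_distrib augmentation_add distrib_right)
qed

context group
begin

lemma group_algebra_mult_closed:
  assumes "Poly_Mapping.keys a \<subseteq> carrier G" "Poly_Mapping.keys b \<subseteq> carrier G"
  shows "Poly_Mapping.keys (a \<otimes>\<^bsub>group_algebra G\<^esub> b) \<subseteq> carrier G"
  using assms
proof (induction a rule: keys_subset_induct)
  case (single g x)
  from single(2) show ?case
  proof (induction b rule: keys_subset_induct)
    case (single h y)
    then show ?case using \<open>g \<in> carrier G\<close> by simp
  next
    case (add a b)
    then show ?case by (simp add: group_algebra_distrib keys_add_subset)
  qed simp
next
  case (add a b)
  then show ?case by (simp add: group_algebra_distrib keys_add_subset)
qed simp

lemma group_algebra_assoc:
  assumes "Poly_Mapping.keys a \<subseteq> carrier G" "Poly_Mapping.keys b \<subseteq> carrier G"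
    "Poly_Mapping.keys c \<subseteq> carrier G"
  shows "(a \<otimes>\<^bsub>group_algebra G\<^esub> b) \<otimes>\<^bsub>group_algebra G\<^esub> c = a \<otimes>\<^bsub>group_algebra G\<^esub> (b \<otimes>\<^bsub>group_algebra G\<^esub> c)"
  using assms
proof (induction a rule: keys_subset_induct)
  case (single g x)
  note g = single(1)
  from single(2,3) show ?case
  proof (induction b rule: keys_subset_induct)
    case (single h y)
    note h = single(1)
    from single(2) show ?case
      by (induction c rule: keys_subset_induct) (use g h in \<open>auto simp: m_assoc mult.assoc group_algebra_distrib\<close>)
  qed (auto simp: group_algebra_distrib)
qed (auto simp: group_algebra_distrib)

lemma group_algebra_one:
  assumes "Poly_Mapping.keys a \<subseteq> carrier G"
  shows "Poly_Mapping.single \<one> 1 \<otimes>\<^bsub>group_algebra G\<^esub> a = a"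
    "a \<otimes>\<^bsub>group_algebra G\<^esub> Poly_Mapping.single \<one> 1 = a"
  using assms by (induction a rule: keys_subset_induct) (auto simp: group_algebra_distrib)

lemma ring_group_algebra: "ring (group_algebra G :: ('a \<Rightarrow>\<^sub>0 'f::field) ring)"
proof (rule ringI)
  show "abelian_group (group_algebra G :: ('a \<Rightarrow>\<^sub>0 'f) ring)"
  proof (rule abelian_groupI)
    fix x :: "'a \<Rightarrow>\<^sub>0 'f" assume "x \<in> carrier (group_algebra G)"
    then show "\<exists>y\<in>carrier (group_algebra G). y \<oplus>\<^bsub>group_algebra G\<^esub> x = \<zero>\<^bsub>group_algebra G\<^esub>"
      by (intro bexI[of _ "- x"]) auto
  qed (auto simp: algebra_simps keys_add_subset)
  show "monoid (group_algebra G :: ('a \<Rightarrow>\<^sub>0 'f) ring)"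
    by (rule monoidI) (simp_all add: group_algebra_mult_closed group_algebra_assoc group_algebra_one)
qed (auto simp: group_algebra_distrib)

end

section \<open>Strong Lie powers of a ring\<close>

abbreviation lie :: "('a, 'm) ring_scheme \<Rightarrow> 'a \<Rightarrow> 'a \<Rightarrow> 'a" where
  "lie R x y \<equiv> x \<otimes>\<^bsub>R\<^esub> y \<ominus>\<^bsub>R\<^esub> y \<otimes>\<^bsub>R\<^esub> x"

text \<open>
  The strong (or upper) Lie power series of an associative ring. It differs from the lower central
  series of the associated Lie ring in that the full ideal is generated at each step.
\<close>

primrec strong_lie_power :: "('a, 'm) ring_scheme \<Rightarrow> nat \<Rightarrow> 'a set" where
  "strong_lie_power R 0 = carrier R"
| "strong_lie_power R (Suc n) =
    genideal R (\<Union>x \<in> strong_lie_power R n. \<Union>y \<in> carrier R. {lie R x y})"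

context ring
begin

lemma lie_mult_left:
  assumes "x \<in> carrier R" "y \<in> carrier R" "z \<in> carrier R"
  shows "lie R (x \<otimes> y) z = x \<otimes> lie R y z \<oplus> lie R x z \<otimes> y"
  using assms by (simp add: minus_eq l_distr r_distr l_minus r_minus m_assoc a_ac r_neg1 r_neg2)

lemma lie_add_left:
  assumes "x \<in> carrier R" "y \<in> carrier R" "z \<in> carrier R"
  shows "lie R (x \<oplus> y) z = lie R x z \<oplus> lie R y z"
  using assms by (simp add: minus_eq l_distr r_distr minus_add a_ac)

lemma strong_lie_power_ideal: "ideal (strong_lie_power R n) R"
proof (induction n)
  case 0
  then show ?case by (simp add: oneideal)
next
  case (Suc n)
  then interpret I: ideal "strong_lie_power R n" R .
  show ?case by (auto intro!: genideal_ideal dest: I.Icarr)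
qed

lemma lie_in_strong_lie_power:
  assumes "x \<in> strong_lie_power R n" "y \<in> carrier R"
  shows "lie R x y \<in> strong_lie_power R (Suc n)"
proof -
  interpret I: ideal "strong_lie_power R n" R by (rule strong_lie_power_ideal)
  have "(\<Union>x \<in> strong_lie_power R n. \<Union>y \<in> carrier R. {lie R x y}) \<subseteq> carrier R"
    by (auto dest: I.Icarr)
  from genideal_self[OF this] show ?thesis using assms by auto
qed

lemma ideal_minus_closed:
  assumes "ideal K R" "a \<in> K" "b \<in> K" shows "a \<ominus> b \<in> K"
proof -
  interpret K: ideal K R by fact
  show ?thesis using assms by (simp add: minus_eq K.a_inv_closed)
qed

text \<open>
  The preimage of \<open>w I\<close> under the projection modulo \<open>K\<close>, that is, the set \<open>w I + K\<close>. The form of a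
  congruence makes closure properties a matter of one identity each.
\<close>

definition multiples_mod :: "'a set \<Rightarrow> 'a \<Rightarrow> 'a set \<Rightarrow> 'a set" where
  "multiples_mod K w I = {a \<in> carrier R. \<exists>i\<in>I. a \<ominus> w \<otimes> i \<in> K}"

lemma multiples_mod_ideal:
  assumes K: "ideal K R" and I: "ideal I R" and w: "w \<in> carrier R"
    and central: "\<And>r. r \<in> carrier R \<Longrightarrow> lie R w r \<in> K"
  shows "ideal (multiples_mod K w I) R"
proof -
  interpret K: ideal K R by fact
  interpret I: ideal I R by fact
  show ?thesis
  proof (rule idealI)
    show "ring R" by (rule ring_axioms)
    show "subgroup (multiples_mod K w I) (add_monoid R)"
    proof (rule add.subgroupI)
      show "multiples_mod K w I \<subseteq> carrier R" by (auto simp: multiples_mod_def)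
      have "\<zero> \<ominus> w \<otimes> \<zero> \<in> K" using w by (simp add: minus_eq)
      then show "multiples_mod K w I \<noteq> {}" by (auto simp: multiples_mod_def intro!: exI[of _ \<zero>])
    next
      fix a assume "a \<in> multiples_mod K w I"
      then obtain i where a: "a \<in> carrier R" "i \<in> I" "a \<ominus> w \<otimes> i \<in> K" by (auto simp: multiples_mod_def)
      have "\<ominus> a \<ominus> w \<otimes> (\<ominus> i) = \<ominus> (a \<ominus> w \<otimes> i)"
        using a w I.Icarr by (simp add: minus_eq r_minus minus_add)
      then have "\<ominus> a \<ominus> w \<otimes> (\<ominus> i) \<in> K" using a K.a_inv_closed by simp
      then show "\<ominus> a \<in> multiples_mod K w I" using a by (auto simp: multiples_mod_def)
    next
      fix a b assume "a \<in> multiples_mod K w I" "b \<in> multiples_mod K w I"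
      then obtain i j where a: "a \<in> carrier R" "i \<in> I" "a \<ominus> w \<otimes> i \<in> K"
        and b: "b \<in> carrier R" "j \<in> I" "b \<ominus> w \<otimes> j \<in> K" by (auto simp: multiples_mod_def)
      have "a \<oplus> b \<ominus> w \<otimes> (i \<oplus> j) = (a \<ominus> w \<otimes> i) \<oplus> (b \<ominus> w \<otimes> j)"
        using a b w I.Icarr by (simp add: minus_eq r_distr minus_add a_ac)
      then have "a \<oplus> b \<ominus> w \<otimes> (i \<oplus> j) \<in> K" using a b by simp
      then show "a \<oplus> b \<in> multiples_mod K w I" using a b by (auto simp: multiples_mod_def)
    qed
  next
    fix a r assume "a \<in> multiples_mod K w I" and r: "r \<in> carrier R"
    then obtain i where a: "a \<in> carrier R" "i \<in> I" "a \<ominus> w \<otimes> i \<in> K" by (auto simp: multiples_mod_def)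
    note i = I.Icarr[OF a(2)]
    have "r \<otimes> a \<ominus> w \<otimes> (r \<otimes> i) = r \<otimes> (a \<ominus> w \<otimes> i) \<ominus> lie R w r \<otimes> i"
      using a w r i by (simp add: minus_eq l_distr r_distr l_minus r_minus minus_add m_assoc a_ac r_neg1 r_neg2)
    then have "r \<otimes> a \<ominus> w \<otimes> (r \<otimes> i) \<in> K"
      using a r i central by (simp add: ideal_minus_closed[OF K] K.I_l_closed K.I_r_closed)
    then show "r \<otimes> a \<in> multiples_mod K w I" using a r I.I_l_closed by (auto simp: multiples_mod_def)
    have "a \<otimes> r \<ominus> w \<otimes> (i \<otimes> r) = (a \<ominus> w \<otimes> i) \<otimes> r"
      using a w r i by (simp add: minus_eq l_distr l_minus m_assoc)
    then have "a \<otimes> r \<ominus> w \<otimes> (i \<otimes> r) \<in> K" using a r by (simp add: K.I_r_closed)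
    then show "a \<otimes> r \<in> multiples_mod K w I" using a r I.I_r_closed by (auto simp: multiples_mod_def)
  qed
qed

text \<open>
  As \<open>w\<close> is central modulo \<open>K\<close>, Lie commutators of \<open>w i\<close> are \<open>w\<close> times Lie commutators of \<open>i\<close> there. After
  reaching \<open>w R + K\<close>, the series thus restarts at \<open>R\<close> behind the factor \<open>w\<close>.
\<close>

lemma strong_lie_power_shift:
  assumes K: "ideal K R" and w: "w \<in> carrier R"
    and central: "\<And>r. r \<in> carrier R \<Longrightarrow> lie R w r \<in> K"
    and sub: "strong_lie_power R m \<subseteq> multiples_mod K w (carrier R)"
  shows "strong_lie_power R (m + j) \<subseteq> multiples_mod K w (strong_lie_power R j)"
proof (induction j)
  case 0
  then show ?case using sub by simp
next
  case (Suc j)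
  interpret K: ideal K R by fact
  interpret I: ideal "strong_lie_power R j" R by (rule strong_lie_power_ideal)
  have "lie R a r \<in> multiples_mod K w (strong_lie_power R (Suc j))"
    if ar: "a \<in> strong_lie_power R (m + j)" and r: "r \<in> carrier R" for a r
  proof -
    obtain i where a: "a \<in> carrier R" "i \<in> strong_lie_power R j" "a \<ominus> w \<otimes> i \<in> K"
      using Suc ar unfolding multiples_mod_def by blast
    note i = I.Icarr[OF a(2)]
    define k where "k = a \<ominus> w \<otimes> i"
    have k: "k \<in> K" "k \<in> carrier R" unfolding k_def using a K.Icarr by auto
    have "a = k \<oplus> w \<otimes> i" unfolding k_def using a w i by (simp add: minus_eq a_assoc l_neg)
    then have "lie R a r = lie R k r \<oplus> (w \<otimes> lie R i r \<oplus> lie R w r \<otimes> i)"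
      using k w i r by (simp add: lie_add_left lie_mult_left)
    then have "lie R a r \<ominus> w \<otimes> lie R i r = lie R k r \<oplus> lie R w r \<otimes> i"
    proof -
      have "(x \<oplus> (y \<oplus> v)) \<ominus> y = x \<oplus> v" if "x \<in> carrier R" "y \<in> carrier R" "v \<in> carrier R" for x y v
      proof -
        have "(x \<oplus> (y \<oplus> v)) \<ominus> y = (x \<oplus> v) \<oplus> (y \<ominus> y)" using that by (simp add: minus_eq a_ac)
        then show ?thesis using that by (simp add: minus_eq r_neg)
      qed
      then show ?thesis using k w i r \<open>lie R a r = _\<close> by simp
    qed
    also have "\<dots> \<in> K"
      using k r i central by (simp add: ideal_minus_closed[OF K] K.I_l_closed K.I_r_closed)
    finally show ?thesis
      using lie_in_strong_lie_power[OF a(2) r] a r unfolding multiples_mod_def by auto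
  qed
  then show ?case
    unfolding add_Suc_right strong_lie_power.simps(2)[of R "m + j"]
    by (intro genideal_minimal[OF multiples_mod_ideal[OF K strong_lie_power_ideal w central]]) auto
qed

text \<open>
  The elements that are central modulo an ideal are closed under products, by the Leibniz rule.
\<close>

lemma lie_pow_mem:
  assumes K: "ideal K R" and z: "z \<in> carrier R"
    and central: "\<And>r. r \<in> carrier R \<Longrightarrow> lie R z r \<in> K" and r: "r \<in> carrier R"
  shows "lie R (z [^] (n::nat)) r \<in> K"
proof (induction n)
  case 0
  interpret K: ideal K R by fact
  show ?case using r by (simp add: minus_eq r_neg)
next
  case (Suc n)
  interpret K: ideal K R by fact
  show ?case using Suc central[OF r] z r
    by (simp add: lie_mult_left K.I_l_closed K.I_r_closed)
qed

text \<open>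
  One nilpotent element that is central modulo \<open>K\<close> does not matter for reaching \<open>K\<close>: every further
  \<open>a\<close> steps of the series produce another factor \<open>z\<close>, and \<open>z\<^sup>q\<close> lies in \<open>K\<close>.
\<close>

lemma strong_lie_power_subset_step:
  assumes K: "ideal K R" and z: "z \<in> carrier R"
    and central: "\<And>r. r \<in> carrier R \<Longrightarrow> lie R z r \<in> K"
    and sub: "strong_lie_power R a \<subseteq> multiples_mod K z (carrier R)"
    and nil: "z [^] (q::nat) \<in> K"
  shows "\<exists>n. strong_lie_power R n \<subseteq> K"
proof -
  interpret K: ideal K R by fact
  have "\<exists>m. strong_lie_power R m \<subseteq> multiples_mod K (z [^] k) (carrier R)" for k :: nat
  proof (induction k)
    case 0
    have "x \<ominus> \<one> \<otimes> x \<in> K" if "x \<in> carrier R" for x using that by (simp add: minus_eq r_neg)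
    then have "strong_lie_power R 0 \<subseteq> multiples_mod K (z [^] (0::nat)) (carrier R)"
      by (auto simp: multiples_mod_def)
    then show ?case by blast
  next
    case (Suc k)
    then obtain m where m: "strong_lie_power R m \<subseteq> multiples_mod K (z [^] k) (carrier R)" by blast
    have sh: "strong_lie_power R (m + a) \<subseteq> multiples_mod K (z [^] k) (strong_lie_power R a)"
      by (rule strong_lie_power_shift[OF K _ lie_pow_mem[OF K z central] m]) (use z in auto)
    have "x \<in> multiples_mod K (z [^] Suc k) (carrier R)" if "x \<in> strong_lie_power R (m + a)" for x
    proof -
      obtain i where x: "x \<in> carrier R" "i \<in> strong_lie_power R a" "x \<ominus> z [^] k \<otimes> i \<in> K"
        using sh \<open>x \<in> strong_lie_power R (m + a)\<close> unfolding multiples_mod_def by blast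
      then obtain j where i: "i \<in> carrier R" "j \<in> carrier R" "i \<ominus> z \<otimes> j \<in> K"
        using sub unfolding multiples_mod_def by blast
      have "x \<ominus> z [^] Suc k \<otimes> j = (x \<ominus> z [^] k \<otimes> i) \<oplus> z [^] k \<otimes> (i \<ominus> z \<otimes> j)"
        using x(1) i(1,2) z by (simp add: minus_eq r_distr r_minus m_assoc a_ac r_neg1 r_neg2)
      also have "\<dots> \<in> K" using x i z by (simp add: K.I_l_closed)
      finally show ?thesis using x i by (auto simp: multiples_mod_def)
    qed
    then show ?case by blast
  qed
  then obtain m where m: "strong_lie_power R m \<subseteq> multiples_mod K (z [^] q) (carrier R)" by blast
  have "x \<in> K" if "x \<in> strong_lie_power R m" for x
  proof -
    obtain i where x: "x \<in> carrier R" "i \<in> carrier R" "x \<ominus> z [^] q \<otimes> i \<in> K"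
      using m \<open>x \<in> _\<close> unfolding multiples_mod_def by blast
    have "x = (x \<ominus> z [^] q \<otimes> i) \<oplus> z [^] q \<otimes> i" using x z by (simp add: minus_eq a_assoc l_neg)
    also have "\<dots> \<in> K" using x nil K.I_r_closed by simp
    finally show ?thesis .
  qed
  then show ?thesis by blast
qed

end

section \<open>Powers of T - 1 in prime characteristic\<close>

text \<open>
  The linear functional on polynomials that sends \<open>X\<^sup>i\<close> to \<open>s i\<close>. Through it the shift on sequences
  becomes multiplication by \<open>X\<close>, and the difference operator becomes multiplication by \<open>X - 1\<close>.
\<close>

definition poly_functional :: "(nat \<Rightarrow> 'a::comm_ring_1) \<Rightarrow> 'a poly \<Rightarrow> 'a" where
  "poly_functional s P = (\<Sum>i\<le>degree P. coeff P i * s i)"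

lemma poly_functional_superset:
  "degree P \<le> n \<Longrightarrow> poly_functional s P = (\<Sum>i\<le>n. coeff P i * s i)"
  unfolding poly_functional_def by (rule sum.mono_neutral_left) (auto simp: coeff_eq_0)

lemma poly_functional_diff:
  "poly_functional s (P - Q) = poly_functional s P - poly_functional s Q"
proof -
  let ?n = "max (degree P) (degree Q)"
  show ?thesis
    using poly_functional_superset[of "P - Q" ?n s] poly_functional_superset[of P ?n s]
      poly_functional_superset[of Q ?n s]
    by (simp add: degree_diff_le_max left_diff_distrib sum_subtractf)
qed

lemma poly_functional_monom: "poly_functional s (monom 1 n) = s n"
  using poly_functional_superset[of "monom 1 n" n s] by (simp add: degree_monom_le if_distrib[of "\<lambda>x. x * _"] cong: if_cong)

lemma difference_iterate:
  "((\<lambda>s k. s (Suc k) - s k) ^^ n) s k = poly_functional s ([:-1, 1:] ^ n * monom 1 k)"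
proof (induction n arbitrary: k)
  case 0
  then show ?case by (simp add: poly_functional_monom)
next
  case (Suc n)
  have m: "monom 1 (Suc k) = [:0, 1:] * (monom 1 k :: 'a poly)" by (simp add: monom_Suc)
  have "[:-1, 1:] ^ Suc n * monom 1 k
      = [:-1, 1:] ^ n * monom 1 (Suc k) - [:-1, 1:] ^ n * (monom 1 k :: 'a poly)"
    unfolding m by (simp add: algebra_simps monom_Suc)
  then show ?case using Suc by (simp add: poly_functional_diff)
qed

text \<open>
  This is \<open>(X - 1)\<^sup>q = X\<^sup>q - 1\<close> for a power \<open>q\<close> of the characteristic.
\<close>

lemma difference_prime_power:
  fixes s :: "nat \<Rightarrow> 'a::comm_ring_1"
  assumes "CHAR('a) = p" "prime p"
  shows "((\<lambda>s k. s (Suc k) - s k) ^^ (p ^ m)) s k = s (k + p ^ m) - s k"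
proof -
  have "([:-1, 1:] + 1 :: 'a poly) ^ (p ^ m) = [:-1, 1:] ^ (p ^ m) + 1 ^ (p ^ m)"
    by (rule freshmans_dream') (use assms in simp_all)
  moreover have "[:-1, 1:] + 1 = (monom 1 1 :: 'a poly)" by (simp add: monom_altdef one_pCons)
  ultimately have "([:-1, 1:] :: 'a poly) ^ (p ^ m) = monom 1 (p ^ m) - 1"
    by (simp add: monom_power)
  then show ?thesis
    by (simp add: difference_iterate left_diff_distrib poly_functional_diff poly_functional_monom
        mult_monom add.commute)
qed

text \<open>
  The identity \<open>(T - 1)\<^sup>q = T\<^sup>q - 1\<close> for an additive operator. Applied to a multiplication it shows that
  \<open>x - 1\<close> is nilpotent for a \<open>p\<close>-element \<open>x\<close>, applied to a conjugation it controls iterated commutators.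
  It is proved coefficient by coefficient: for fixed \<open>y\<close>, the coefficients of \<open>T\<^sup>k v\<close> at \<open>y\<close> form a
  sequence on which \<open>T - 1\<close> acts as the difference operator.
\<close>

lemma additive_minus_id_prime_power:
  fixes T :: "('g \<Rightarrow>\<^sub>0 'f::comm_ring_1) \<Rightarrow> ('g \<Rightarrow>\<^sub>0 'f)"
  assumes T: "\<And>a b. T (a - b) = T a - T b" and p: "CHAR('f) = p" "prime p"
  shows "((\<lambda>v. T v - v) ^^ (p ^ m)) v = (T ^^ (p ^ m)) v - v"
proof -
  let ?D = "\<lambda>v. T v - v"
  have D: "(?D ^^ n) (a - b) = (?D ^^ n) a - (?D ^^ n) b" for n a b
    by (induction n) (simp_all add: T)
  have "Poly_Mapping.lookup ((?D ^^ n) ((T ^^ k) v)) y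
      = ((\<lambda>s k. s (Suc k) - s k) ^^ n) (\<lambda>k. Poly_Mapping.lookup ((T ^^ k) v) y) k" for n k y
  proof (induction n arbitrary: k)
    case (Suc n)
    have "(?D ^^ Suc n) ((T ^^ k) v) = (?D ^^ n) ((T ^^ Suc k) v) - (?D ^^ n) ((T ^^ k) v)"
      unfolding funpow_Suc_right o_apply D by (simp add: funpow_swap1)
    then have "Poly_Mapping.lookup ((?D ^^ Suc n) ((T ^^ k) v)) y
        = Poly_Mapping.lookup ((?D ^^ n) ((T ^^ Suc k) v)) y - Poly_Mapping.lookup ((?D ^^ n) ((T ^^ k) v)) y"
      by (simp only: lookup_minus)
    then show ?case unfolding Suc by simp
  qed simp
  from this[of "p ^ m" 0] show ?thesis
    by (intro poly_mapping_eqI) (simp add: difference_prime_power[OF p] lookup_minus)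
qed

section \<open>Strong Lie powers of a group algebra\<close>

text \<open>
  The kernel of the composition of a representation \<open>f\<close> of \<open>H\<close> by units with the projection modulo \<open>A\<close>.
  It is used for the embedding of a group into its group algebra and for the inclusion of a group of
  units.
\<close>

lemma (in ring) subgroup_one_mod_ideal:
  assumes H: "group H" and f: "f \<in> hom H R" "f \<one>\<^bsub>H\<^esub> = \<one>" and A: "ideal A R"
  shows "subgroup {h \<in> carrier H. f h \<ominus> \<one> \<in> A} H"
proof -
  interpret H: group H by fact
  interpret A: ideal A R by fact
  have fc: "h \<in> carrier H \<Longrightarrow> f h \<in> carrier R" for h using f(1) by (rule hom_in_carrier)
  show ?thesis
  proof (rule H.subgroupI, goal_cases)
    case 1 then show ?case by auto
  next
    case 2 then show ?case using f(2) by (auto intro!: exI[of _ "\<one>\<^bsub>H\<^esub>"] simp: minus_eq r_neg)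
  next
    case (3 h)
    then have h: "h \<in> carrier H" "f h \<ominus> \<one> \<in> A" by auto
    let ?i = "f (inv\<^bsub>H\<^esub> h)"
    have i: "?i \<otimes> f h = \<one>" using h f hom_mult[OF f(1), of "inv\<^bsub>H\<^esub> h" h] by simp
    have "\<ominus> (?i \<otimes> (f h \<ominus> \<one>)) = ?i \<ominus> \<one>"
      using h fc i by (simp add: minus_eq r_distr r_minus minus_add a_comm)
    then show ?case using h fc A.I_l_closed A.a_inv_closed by (metis (no_types, lifting) H.inv_closed mem_Collect_eq)
  next
    case (4 h k)
    then have h: "h \<in> carrier H" "f h \<ominus> \<one> \<in> A" and k: "k \<in> carrier H" "f k \<ominus> \<one> \<in> A" by auto
    have "f (h \<otimes>\<^bsub>H\<^esub> k) \<ominus> \<one> = f h \<otimes> (f k \<ominus> \<one>) \<oplus> (f h \<ominus> \<one>)"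
      using h(1) k(1) fc hom_mult[OF f(1)] by (simp add: minus_eq r_distr r_minus a_assoc l_neg r_neg1)
    also have "\<dots> \<in> A" using h k fc by (simp add: A.I_l_closed)
    finally show ?case using h k by simp
  qed
qed

lemma group_algebra_diff_distrib:
  "(a - b) \<otimes>\<^bsub>group_algebra G\<^esub> c = a \<otimes>\<^bsub>group_algebra G\<^esub> c - b \<otimes>\<^bsub>group_algebra G\<^esub> c"
  "c \<otimes>\<^bsub>group_algebra G\<^esub> (a - b) = c \<otimes>\<^bsub>group_algebra G\<^esub> a - c \<otimes>\<^bsub>group_algebra G\<^esub> b"
  using group_algebra_distrib(1)[where a = "a - b" and b = b and c = c and G = G]
    group_algebra_distrib(2)[where a = "a - b" and b = b and c = c and G = G] by simp_all

lemma ideal_group_algebra: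
  assumes "ideal A (group_algebra G)"
  shows "0 \<in> A" "\<lbrakk>a \<in> A; b \<in> A\<rbrakk> \<Longrightarrow> a + b \<in> A"
  using additive_subgroup.zero_closed[OF ideal.axioms(1)[OF assms]]
    additive_subgroup.a_closed[OF ideal.axioms(1)[OF assms]] by simp_all

abbreviation basis :: "'g \<Rightarrow> ('g \<Rightarrow>\<^sub>0 'f::field)" where
  "basis g \<equiv> Poly_Mapping.single g 1"

text \<open>
  If \<open>N\<close> is a normal subgroup, this is the kernel of the projection onto the group algebra of the
  quotient by \<open>N\<close>. The definition makes sense for any set \<open>N\<close>, which allows generators to be
  discarded one by one without regard to normality.
\<close>

definition relative_augmentation_ideal ::
    "('g, 'm) monoid_scheme \<Rightarrow> 'g set \<Rightarrow> ('g \<Rightarrow>\<^sub>0 'f::field) set" where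
  "relative_augmentation_ideal G N = genideal (group_algebra G) ((\<lambda>x. basis x - basis \<one>\<^bsub>G\<^esub>) ` N)"

context group
begin

lemma group_algebra_minus [simp]:
  assumes "Poly_Mapping.keys (b :: 'a \<Rightarrow>\<^sub>0 'f::field) \<subseteq> carrier G"
  shows "a \<ominus>\<^bsub>group_algebra G\<^esub> b = a - b"
proof -
  interpret R: ring "group_algebra G :: ('a \<Rightarrow>\<^sub>0 'f) ring" by (rule ring_group_algebra)
  have "\<ominus>\<^bsub>group_algebra G\<^esub> b = - b" using assms by (intro R.minus_equality) simp_all
  then show ?thesis by (simp add: a_minus_def)
qed

lemma relative_augmentation_ideal:
  assumes "N \<subseteq> carrier G"
  shows "ideal (relative_augmentation_ideal G N :: ('a \<Rightarrow>\<^sub>0 'f::field) set) (group_algebra G)"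
    "x \<in> N \<Longrightarrow> basis x - basis \<one> \<in> (relative_augmentation_ideal G N :: ('a \<Rightarrow>\<^sub>0 'f::field) set)"
    "\<lbrakk>ideal A (group_algebra G); \<And>x. x \<in> N \<Longrightarrow> basis x - basis \<one> \<in> A\<rbrakk>
       \<Longrightarrow> relative_augmentation_ideal G N \<subseteq> (A :: ('a \<Rightarrow>\<^sub>0 'f::field) set)"
proof -
  interpret R: ring "group_algebra G :: ('a \<Rightarrow>\<^sub>0 'f) ring" by (rule ring_group_algebra)
  have sub: "(\<lambda>x. basis x - basis \<one>) ` N \<subseteq> carrier (group_algebra G :: ('a \<Rightarrow>\<^sub>0 'f) ring)"
    using assms keys_diff[of "basis _ :: 'a \<Rightarrow>\<^sub>0 'f" "basis \<one>"] by fastforce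
  show "ideal (relative_augmentation_ideal G N :: ('a \<Rightarrow>\<^sub>0 'f) set) (group_algebra G)"
    unfolding relative_augmentation_ideal_def by (rule R.genideal_ideal[OF sub])
  show "x \<in> N \<Longrightarrow> basis x - basis \<one> \<in> (relative_augmentation_ideal G N :: ('a \<Rightarrow>\<^sub>0 'f) set)"
    unfolding relative_augmentation_ideal_def using R.genideal_self[OF sub] by blast
  show "relative_augmentation_ideal G N \<subseteq> A"
    if "ideal A (group_algebra G)" "\<And>x. x \<in> N \<Longrightarrow> basis x - basis \<one> \<in> A" for A :: "('a \<Rightarrow>\<^sub>0 'f) set"
    unfolding relative_augmentation_ideal_def by (rule R.genideal_minimal[OF that(1)]) (use that(2) in blast)
qed

lemma relative_augmentation_ideal_generate:
  assumes "N \<subseteq> carrier G"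
  shows "relative_augmentation_ideal G (generate G N)
     \<subseteq> (relative_augmentation_ideal G N :: ('a \<Rightarrow>\<^sub>0 'f::field) set)"
proof -
  interpret R: ring "group_algebra G :: ('a \<Rightarrow>\<^sub>0 'f) ring" by (rule ring_group_algebra)
  let ?A = "relative_augmentation_ideal G N :: ('a \<Rightarrow>\<^sub>0 'f) set"
  have "subgroup {x \<in> carrier G. basis x \<ominus>\<^bsub>group_algebra G\<^esub> \<one>\<^bsub>group_algebra G\<^esub> \<in> ?A} G"
    by (rule R.subgroup_one_mod_ideal) (auto intro!: homI relative_augmentation_ideal(1) assms)
  then have "generate G N \<subseteq> {x \<in> carrier G. basis x - basis \<one> \<in> ?A}"
    using relative_augmentation_ideal(2)[OF assms, where ?'f = 'f] assms
    by (intro generate_subgroup_incl) auto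
  then show ?thesis
    by (intro relative_augmentation_ideal(3) relative_augmentation_ideal(1) assms) (use generate_incl[OF assms] in auto)
qed

text \<open>
  On group elements this is the identity \<open>x y - y x = ([x, y] - 1) y x\<close>.
\<close>

lemma lie_basis_mem:
  fixes A :: "('a \<Rightarrow>\<^sub>0 'f::field) set"
  assumes A: "ideal A (group_algebra G)" and x: "x \<in> carrier G"
    and comm: "\<And>y. y \<in> carrier G \<Longrightarrow> basis (commutator G x y) - basis \<one> \<in> A"
    and r: "Poly_Mapping.keys r \<subseteq> carrier G"
  shows "Poly_Mapping.single x c \<otimes>\<^bsub>group_algebra G\<^esub> r - r \<otimes>\<^bsub>group_algebra G\<^esub> Poly_Mapping.single x c \<in> A"
  using r
proof (induction r rule: keys_subset_induct)
  interpret A: ideal A "group_algebra G" by fact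
  case zero
  show ?case using ideal_group_algebra(1)[OF A] by simp
next
  interpret A: ideal A "group_algebra G" by fact
  case (single y d)
  have "x \<otimes> y = commutator G x y \<otimes> (y \<otimes> x)" using x single by (simp add: m_assoc)
  then have "Poly_Mapping.single x c \<otimes>\<^bsub>group_algebra G\<^esub> Poly_Mapping.single y d
      - Poly_Mapping.single y d \<otimes>\<^bsub>group_algebra G\<^esub> Poly_Mapping.single x c
      = (basis (commutator G x y) - basis \<one>) \<otimes>\<^bsub>group_algebra G\<^esub> Poly_Mapping.single (y \<otimes> x) (c * d)"
    using x single by (simp add: group_algebra_diff_distrib mult.commute)
  also have "\<dots> \<in> A" by (rule A.I_r_closed[OF comm[OF single]]) (use x single in simp)
  finally show ?case .
next
  interpret A: ideal A "group_algebra G" by fact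
  case (add a b)
  then show ?case using ideal_group_algebra(2)[OF A, of "Poly_Mapping.single x c \<otimes>\<^bsub>group_algebra G\<^esub> a - a \<otimes>\<^bsub>group_algebra G\<^esub> Poly_Mapping.single x c"
      "Poly_Mapping.single x c \<otimes>\<^bsub>group_algebra G\<^esub> b - b \<otimes>\<^bsub>group_algebra G\<^esub> Poly_Mapping.single x c"]
    by (simp add: group_algebra_distrib algebra_simps)
qed

lemma strong_lie_power_one_subset:
  "strong_lie_power (group_algebra G) (Suc 0)
     \<subseteq> (relative_augmentation_ideal G (lower_central_series G (Suc 0)) :: ('a \<Rightarrow>\<^sub>0 'f::field) set)"
proof -
  interpret R: ring "group_algebra G :: ('a \<Rightarrow>\<^sub>0 'f) ring" by (rule ring_group_algebra)
  let ?A = "relative_augmentation_ideal G (lower_central_series G (Suc 0)) :: ('a \<Rightarrow>\<^sub>0 'f) set"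
  have A: "ideal ?A (group_algebra G)" by (rule relative_augmentation_ideal(1)[OF lcs_subset])
  interpret A: ideal ?A "group_algebra G" by (rule A)
  have "a \<otimes>\<^bsub>group_algebra G\<^esub> b - b \<otimes>\<^bsub>group_algebra G\<^esub> a \<in> ?A"
    if a: "Poly_Mapping.keys a \<subseteq> carrier G" and b: "Poly_Mapping.keys b \<subseteq> carrier G" for a b :: "'a \<Rightarrow>\<^sub>0 'f"
    using a
  proof (induction a rule: keys_subset_induct)
    case zero
    show ?case using ideal_group_algebra(1)[OF A] by simp
  next
    case (single x c)
    show ?case
      by (rule lie_basis_mem[OF A single _ b], rule relative_augmentation_ideal(2)[OF lcs_subset lcs_commutator])
        (use single in simp_all)
  next
    case (add a c)
    then show ?case using ideal_group_algebra(2)[OF A, of "a \<otimes>\<^bsub>group_algebra G\<^esub> b - b \<otimes>\<^bsub>group_algebra G\<^esub> a"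
        "c \<otimes>\<^bsub>group_algebra G\<^esub> b - b \<otimes>\<^bsub>group_algebra G\<^esub> c"]
      by (simp add: group_algebra_distrib algebra_simps)
  qed
  then show ?thesis
    unfolding strong_lie_power.simps
    by (intro R.genideal_minimal[OF A]) (auto simp: group_algebra_mult_closed)
qed

text \<open>
  Multiplication by \<open>x - 1\<close> is \<open>T - 1\<close> for the operator \<open>T\<close> of multiplication by \<open>x\<close>. As these operators act
  on finitely supported functions of any kind, the proof also keeps track of the supports.
\<close>

lemma basis_minus_one_prime_power:
  assumes "CHAR('f::field) = p" "prime p" and x: "x \<in> carrier G"
  shows "(basis x - basis \<one> :: 'a \<Rightarrow>\<^sub>0 'f) [^]\<^bsub>group_algebra G\<^esub> (p ^ m :: nat) = basis (x [^] (p ^ m)) - basis \<one>"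
proof -
  interpret R: ring "group_algebra G :: ('a \<Rightarrow>\<^sub>0 'f) ring" by (rule ring_group_algebra)
  let ?T = "\<lambda>v :: 'a \<Rightarrow>\<^sub>0 'f. v \<otimes>\<^bsub>group_algebra G\<^esub> basis x"
  have "(?T ^^ n) (basis \<one>) = basis (x [^] n)" for n :: nat
    using x by (induction n) simp_all
  moreover have "(basis x - basis \<one>) [^]\<^bsub>group_algebra G\<^esub> n = ((\<lambda>v. ?T v - v) ^^ n) (basis \<one>)
      \<and> Poly_Mapping.keys (((\<lambda>v. ?T v - v) ^^ n) (basis \<one>)) \<subseteq> carrier G" for n :: nat
  proof (induction n)
    case (Suc n)
    let ?v = "((\<lambda>v. ?T v - v) ^^ n) (basis \<one>)"
    have "Poly_Mapping.keys (?T ?v) \<subseteq> carrier G" using Suc x by (intro group_algebra_mult_closed) auto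
    then have "Poly_Mapping.keys (?T ?v - ?v) \<subseteq> carrier G" using keys_diff[of "?T ?v" ?v] Suc by blast
    then show ?case using Suc by (simp add: group_algebra_diff_distrib group_algebra_one)
  qed simp
  ultimately show ?thesis
    using additive_minus_id_prime_power[OF _ assms(1,2), of ?T m "basis \<one>"]
    by (simp add: group_algebra_diff_distrib)
qed

text \<open>
  Modulo \<open>I(N)\<close> the element \<open>z = x - 1\<close> is central, because \<open>N\<close> contains the commutators of \<open>x\<close>, and it is
  nilpotent; moreover \<open>I(N \<union> {x})\<close> is \<open>z R + I(N)\<close>. So \<open>strong_lie_power_subset_step\<close> applies.
\<close>

lemma strong_lie_power_remove_generator:
  assumes p: "CHAR('f::field) = p" "prime p"
    and N: "N \<subseteq> carrier G" and x: "x \<in> carrier G" "x [^] (p ^ m :: nat) = \<one>"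
    and comm: "\<And>y. y \<in> carrier G \<Longrightarrow> commutator G x y \<in> N"
    and sub: "strong_lie_power (group_algebra G) a
      \<subseteq> (relative_augmentation_ideal G (insert x N) :: ('a \<Rightarrow>\<^sub>0 'f) set)"
  shows "\<exists>n. strong_lie_power (group_algebra G) n \<subseteq> (relative_augmentation_ideal G N :: ('a \<Rightarrow>\<^sub>0 'f) set)"
proof -
  interpret R: ring "group_algebra G :: ('a \<Rightarrow>\<^sub>0 'f) ring" by (rule ring_group_algebra)
  let ?A = "relative_augmentation_ideal G N :: ('a \<Rightarrow>\<^sub>0 'f) set"
  let ?z = "basis x - basis \<one> :: 'a \<Rightarrow>\<^sub>0 'f"
  note A = relative_augmentation_ideal(1)[OF N, where ?'f = 'f]
  interpret A: ideal ?A "group_algebra G" by (rule A)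
  have z: "Poly_Mapping.keys ?z \<subseteq> carrier G"
    using keys_diff[of "basis x :: 'a \<Rightarrow>\<^sub>0 'f" "basis \<one>"] x by auto
  have central: "lie (group_algebra G) ?z r \<in> ?A" if "r \<in> carrier (group_algebra G)" for r
  proof -
    have "basis x \<otimes>\<^bsub>group_algebra G\<^esub> r - r \<otimes>\<^bsub>group_algebra G\<^esub> basis x \<in> ?A"
      by (rule lie_basis_mem[OF A x(1)]) (use relative_augmentation_ideal(2)[OF N] comm that in auto)
    moreover have "Poly_Mapping.keys (r \<otimes>\<^bsub>group_algebra G\<^esub> ?z) \<subseteq> carrier G"
      using that z by (intro group_algebra_mult_closed) auto
    from group_algebra_minus[OF this] have "lie (group_algebra G) ?z r
        = basis x \<otimes>\<^bsub>group_algebra G\<^esub> r - r \<otimes>\<^bsub>group_algebra G\<^esub> basis x"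
      using that by (simp add: group_algebra_diff_distrib group_algebra_one)
    ultimately show ?thesis by simp
  qed
  have M: "ideal (R.multiples_mod ?A ?z (carrier (group_algebra G))) (group_algebra G)"
    by (rule R.multiples_mod_ideal[OF A R.oneideal _ central]) (use z in auto)
  have "relative_augmentation_ideal G (insert x N) \<subseteq> R.multiples_mod ?A ?z (carrier (group_algebra G))"
  proof (rule relative_augmentation_ideal(3)[OF _ M])
    show "insert x N \<subseteq> carrier G" using x N by simp
    fix y assume y: "y \<in> insert x N"
    have k: "Poly_Mapping.keys (basis y - basis \<one> :: 'a \<Rightarrow>\<^sub>0 'f) \<subseteq> carrier G"
      using keys_diff[of "basis y :: 'a \<Rightarrow>\<^sub>0 'f" "basis \<one>"] y x N by auto
    show "basis y - basis \<one> \<in> R.multiples_mod ?A ?z (carrier (group_algebra G))"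
    proof (cases "y = x")
      case True
      then show ?thesis using z ideal_group_algebra(1)[OF A] unfolding R.multiples_mod_def
        by (auto intro!: exI[of _ "basis \<one>"] simp: group_algebra_one)
    next
      case False
      then have "basis y - basis \<one> \<in> ?A" using y relative_augmentation_ideal(2)[OF N] by auto
      then show ?thesis using k unfolding R.multiples_mod_def by (auto intro!: exI[of _ 0])
    qed
  qed
  then have "strong_lie_power (group_algebra G) a \<subseteq> R.multiples_mod ?A ?z (carrier (group_algebra G))"
    using sub by blast
  moreover have "?z [^]\<^bsub>group_algebra G\<^esub> (p ^ m) \<in> ?A"
    using basis_minus_one_prime_power[OF p x(1)] x ideal_group_algebra(1)[OF A] by simp
  ultimately show ?thesis
    using R.strong_lie_power_subset_step[OF A _ central] z by auto
qed

text \<open>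
  The commutators of generators of one factor with generators of \<open>G\<close> generate the next factor, so
  finiteness is inherited along the whole series.
\<close>

lemma lcs_finitely_generated:
  assumes S: "finite S" "S \<subseteq> carrier G" "carrier G = generate G S"
  shows "\<exists>X. finite X \<and> X \<subseteq> lower_central_series G n
    \<and> lower_central_series G n = generate G (X \<union> lower_central_series G (Suc n))"
proof (induction n)
  case 0
  have "generate G S \<subseteq> generate G (S \<union> lower_central_series G (Suc 0))" by (rule mono_generate) simp
  moreover have "generate G (S \<union> lower_central_series G (Suc 0)) \<subseteq> carrier G"
    using S lcs_subset by (intro generate_incl) blast
  ultimately show ?case using S by (intro exI[of _ S]) auto
next
  case (Suc n)
  then obtain X where X: "finite X" "X \<subseteq> lower_central_series G n"
    "lower_central_series G n = generate G (X \<union> lower_central_series G (Suc n))" by blast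
  let ?Y = "\<Union>x\<in>X. commutator G x ` S"
  have "?Y \<subseteq> lower_central_series G (Suc n)" using lcs_commutator X S by blast
  then show ?case using lcs_generated_step[OF S(2,3) X(2,3)] X(1) S(1) by (intro exI[of _ ?Y]) auto
qed

text \<open>
  From one term of the lower central series to the next, discard the finitely many generators of the
  factor one after the other. Beyond the nilpotency class the ideal is zero.
\<close>

lemma strong_lie_power_eventually_zero:
  assumes p: "CHAR('f::field) = p" "prime p"
    and S: "finite S" "S \<subseteq> carrier G" "carrier G = generate G S"
    and nil: "lower_central_series G c = {\<one>}"
    and tors: "\<And>x. x \<in> lower_central_series G (Suc 0) \<Longrightarrow> \<exists>m. x [^] (p ^ m :: nat) = \<one>"
  shows "\<exists>n. strong_lie_power (group_algebra G) n \<subseteq> {0 :: 'a \<Rightarrow>\<^sub>0 'f}"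
proof -
  interpret R: ring "group_algebra G :: ('a \<Rightarrow>\<^sub>0 'f) ring" by (rule ring_group_algebra)
  let ?I = "\<lambda>N. relative_augmentation_ideal G N :: ('a \<Rightarrow>\<^sub>0 'f) set"
  let ?g = "lower_central_series G"
  have "\<exists>n. strong_lie_power (group_algebra G) n \<subseteq> ?I (?g (Suc i))" for i
  proof (induction i)
    case 0
    show ?case using strong_lie_power_one_subset by blast
  next
    case (Suc i)
    then obtain n where n: "strong_lie_power (group_algebra G) n \<subseteq> ?I (?g (Suc i))" by blast
    obtain X where X: "finite X" "X \<subseteq> ?g (Suc i)" "?g (Suc i) = generate G (X \<union> ?g (Suc (Suc i)))"
      using lcs_finitely_generated[OF S] by blast
    have red: "\<exists>n. strong_lie_power (group_algebra G) n \<subseteq> ?I (?g (Suc (Suc i)))"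
      if "finite Y" "Y \<subseteq> ?g (Suc i)" "strong_lie_power (group_algebra G) n \<subseteq> ?I (Y \<union> ?g (Suc (Suc i)))" for Y n
      using that
    proof (induction Y arbitrary: n)
      case empty
      then show ?case by auto
    next
      case (insert x Y)
      have x: "x \<in> ?g (Suc i)" using insert by simp
      then obtain m where m: "x [^] (p ^ m) = \<one>" using tors lcs_antimono[of "Suc 0" "Suc i"] by auto
      have "\<exists>n. strong_lie_power (group_algebra G) n \<subseteq> ?I (Y \<union> ?g (Suc (Suc i)))"
      proof (rule strong_lie_power_remove_generator[OF p _ lcs_in_carrier[OF x] m])
        show "Y \<union> ?g (Suc (Suc i)) \<subseteq> carrier G" using insert lcs_subset by blast
        show "commutator G x y \<in> Y \<union> ?g (Suc (Suc i))" if "y \<in> carrier G" for y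
          using lcs_commutator[OF x that] by blast
        show "strong_lie_power (group_algebra G) n \<subseteq> ?I (insert x (Y \<union> ?g (Suc (Suc i))))"
          using insert by simp
      qed
      then show ?case using insert by auto
    qed
    have "?I (?g (Suc i)) \<subseteq> ?I (X \<union> ?g (Suc (Suc i)))"
      using relative_augmentation_ideal_generate[of "X \<union> ?g (Suc (Suc i))", where ?'f = 'f] X lcs_subset
      by (metis Un_least order_trans)
    then show ?case using red[OF X(1,2)] n by blast
  qed
  then obtain n where n: "strong_lie_power (group_algebra G) n \<subseteq> ?I (?g (Suc c))" by blast
  have "?I (?g (Suc c)) \<subseteq> {0}"
  proof (rule relative_augmentation_ideal(3)[OF lcs_subset])
    show "ideal {0 :: 'a \<Rightarrow>\<^sub>0 'f} (group_algebra G)" using R.zeroideal by simp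
    show "basis x - basis \<one> \<in> {0 :: 'a \<Rightarrow>\<^sub>0 'f}" if "x \<in> ?g (Suc c)" for x
      using that lcs_Suc_subset[of c] nil by auto
  qed
  then show ?thesis using n by blast
qed

end

section \<open>The group of normalized units\<close>

lemma normalized_units_simps [simp]:
  "carrier (normalized_units G) = {u \<in> Units (group_algebra G). augmentation u = 1}"
  "monoid.mult (normalized_units G) = monoid.mult (group_algebra G)"
  "\<one>\<^bsub>normalized_units G\<^esub> = basis \<one>\<^bsub>G\<^esub>"
  by (simp_all add: normalized_units_def units_of_def)

context ring
begin

lemma lie_minus_one:
  assumes "x \<in> carrier R" "y \<in> carrier R"
  shows "lie R (x \<ominus> \<one>) y = lie R x y"
proof -
  have "lie R (x \<ominus> \<one>) y = (x \<otimes> y \<ominus> y \<otimes> x) \<oplus> (\<ominus> y \<oplus> y)"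
    using assms by (simp add: minus_eq l_distr r_distr l_minus r_minus minus_add a_ac)
  then show ?thesis using assms by (simp add: l_neg)
qed

lemma minus_mult_right:
  assumes "x \<in> carrier R" "y \<in> carrier R" "w \<in> carrier R"
  shows "(x \<ominus> y) \<otimes> w = x \<otimes> w \<ominus> y \<otimes> w"
  using assms by (simp add: minus_eq l_distr l_minus)

end

context group
begin

lemma group_normalized_units: "group (normalized_units G :: ('a \<Rightarrow>\<^sub>0 'f::field) monoid)"
proof -
  let ?R = "group_algebra G :: ('a \<Rightarrow>\<^sub>0 'f) ring"
  interpret R: ring ?R by (rule ring_group_algebra)
  interpret U: group "units_of ?R" by (rule R.units_group)
  let ?V = "{u \<in> Units ?R. augmentation u = 1}"
  have "subgroup ?V (units_of ?R)"
  proof (rule U.subgroupI)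
    show "?V \<subseteq> carrier (units_of ?R)" by (auto simp: units_of_carrier)
    show "?V \<noteq> {}" using R.Units_one_closed by (auto intro!: exI[of _ "basis \<one>"])
  next
    fix u assume u: "u \<in> ?V"
    then have "augmentation (inv\<^bsub>?R\<^esub> u \<otimes>\<^bsub>?R\<^esub> u) = 1" by (simp del: group_algebra_mult_single)
    then have "augmentation (inv\<^bsub>?R\<^esub> u) = 1" using u by (simp add: augmentation_mult)
    then show "inv\<^bsub>units_of ?R\<^esub> u \<in> ?V" using u by (simp add: R.units_of_inv)
  next
    fix u v assume "u \<in> ?V" "v \<in> ?V"
    then show "u \<otimes>\<^bsub>units_of ?R\<^esub> v \<in> ?V" by (simp add: units_of_mult augmentation_mult)
  qed
  then show ?thesis unfolding normalized_units_def by (rule U.subgroup_imp_group)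
qed

lemma normalized_unitsI:
  assumes "Poly_Mapping.keys u \<subseteq> carrier G" "Poly_Mapping.keys v \<subseteq> carrier G" "augmentation u = 1"
    and "u \<otimes>\<^bsub>group_algebra G\<^esub> v = basis \<one>" "v \<otimes>\<^bsub>group_algebra G\<^esub> u = basis \<one>"
  shows "u \<in> carrier (normalized_units G)"
  using assms unfolding normalized_units_simps Units_def by auto

lemma group_hom_basis:
  "group_hom G (normalized_units G :: ('a \<Rightarrow>\<^sub>0 'f::field) monoid) basis"
proof -
  have "basis g \<in> carrier (normalized_units G :: ('a \<Rightarrow>\<^sub>0 'f) monoid)" if "g \<in> carrier G" for g
    by (rule normalized_unitsI[of _ "basis (inv g)"]) (use that in simp_all)
  then have "basis \<in> hom G (normalized_units G :: ('a \<Rightarrow>\<^sub>0 'f) monoid)"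
    by (intro homI) simp_all
  then show ?thesis
    using group_normalized_units is_group by (simp add: group_hom_def group_hom_axioms_def)
qed

lemma inj_basis: "inj_on (basis :: 'a \<Rightarrow> 'a \<Rightarrow>\<^sub>0 'f::field) A"
  by (rule inj_onI) (metis keys_single singleton_inject zero_neq_one)

lemma group_hom_normalized_units_subgroup_generated:
  "group_hom (normalized_units (subgroup_generated G T) :: ('a \<Rightarrow>\<^sub>0 'f::field) monoid)
     (normalized_units G) (\<lambda>u. u)"
proof -
  let ?K = "subgroup_generated G T"
  interpret K: group ?K by simp
  have m: "monoid.mult (group_algebra ?K :: ('a \<Rightarrow>\<^sub>0 'f) ring) = monoid.mult (group_algebra G)"
    by (simp add: group_algebra_def)
  have sub: "carrier ?K \<subseteq> carrier G" by (rule carrier_subgroup_generated_subset)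
  have "carrier (normalized_units ?K :: ('a \<Rightarrow>\<^sub>0 'f) monoid) \<subseteq> carrier (normalized_units G)"
    unfolding normalized_units_simps Units_def m using sub by auto
  then have "(\<lambda>u. u) \<in> hom (normalized_units ?K :: ('a \<Rightarrow>\<^sub>0 'f) monoid) (normalized_units G)"
    using m by (intro homI) auto
  then show ?thesis
    using group_normalized_units K.group_normalized_units by (simp add: group_hom_def group_hom_axioms_def)
qed

text \<open>
  The set of normalized units in \<open>1 + L\<^sub>n\<close> is a subgroup, and it contains the generating commutators of
  the corresponding term of the lower central series because
  \<open>[x, y] - 1 = (x y - y x) x\<inverse> y\<inverse>\<close> and \<open>x y - y x = (x - 1) y - y (x - 1)\<close>.
\<close>

lemma nilpotent_normalized_units:
  assumes zero: "strong_lie_power (group_algebra G) n \<subseteq> {0 :: 'a \<Rightarrow>\<^sub>0 'f::field}"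
  shows "nilpotent_group (normalized_units G :: ('a \<Rightarrow>\<^sub>0 'f) monoid)"
proof -
  let ?R = "group_algebra G :: ('a \<Rightarrow>\<^sub>0 'f) ring"
  let ?V = "normalized_units G :: ('a \<Rightarrow>\<^sub>0 'f) monoid"
  interpret R: ring ?R by (rule ring_group_algebra)
  interpret V: group ?V by (rule group_normalized_units)
  have VR: "u \<in> carrier ?R" if "u \<in> carrier ?V" for u using that R.Units_closed by simp
  have "lower_central_series ?V n \<subseteq> {u \<in> carrier ?V. u \<ominus>\<^bsub>?R\<^esub> \<one>\<^bsub>?R\<^esub> \<in> strong_lie_power ?R n}" for n
  proof (induction n)
    case 0
    show ?case using VR by (auto simp del: normalized_units_simps group_algebra_simps)
  next
    case (Suc n)
    have id: "(\<lambda>u. u) \<in> hom ?V ?R" using VR by (intro homI) simp_all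
    have sub: "subgroup {u \<in> carrier ?V. u \<ominus>\<^bsub>?R\<^esub> \<one>\<^bsub>?R\<^esub> \<in> strong_lie_power ?R (Suc n)} ?V"
      by (rule R.subgroup_one_mod_ideal[OF V.is_group id _ R.strong_lie_power_ideal]) simp
    have "commutator ?V x y \<ominus>\<^bsub>?R\<^esub> \<one>\<^bsub>?R\<^esub> \<in> strong_lie_power ?R (Suc n)"
      if x: "x \<in> lower_central_series ?V n" and y: "y \<in> carrier ?V" for x y
    proof -
      interpret I: ideal "strong_lie_power ?R (Suc n)" ?R by (rule R.strong_lie_power_ideal)
      have xV: "x \<in> carrier ?V" and x1: "x \<ominus>\<^bsub>?R\<^esub> \<one>\<^bsub>?R\<^esub> \<in> strong_lie_power ?R n" using Suc x by auto
      define w where "w = inv\<^bsub>?V\<^esub> x \<otimes>\<^bsub>?V\<^esub> inv\<^bsub>?V\<^esub> y"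
      have w: "w \<in> carrier ?V" unfolding w_def using xV y by blast
      have yxw: "(y \<otimes>\<^bsub>?V\<^esub> x) \<otimes>\<^bsub>?V\<^esub> w = \<one>\<^bsub>?V\<^esub>"
        unfolding w_def using xV y by (simp add: V.m_assoc del: normalized_units_simps)
      have c: "commutator ?V x y = (x \<otimes>\<^bsub>?V\<^esub> y) \<otimes>\<^bsub>?V\<^esub> w"
        unfolding w_def using xV y by (simp add: V.m_assoc del: normalized_units_simps)
      note [simp] = VR[OF xV] VR[OF y] VR[OF w]
      have lie: "lie ?R x y \<in> strong_lie_power ?R (Suc n)"
      proof -
        have "lie ?R (x \<ominus>\<^bsub>?R\<^esub> \<one>\<^bsub>?R\<^esub>) y = lie ?R x y"
          by (rule R.lie_minus_one) (fact VR[OF xV] VR[OF y])+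
        then show ?thesis using R.lie_in_strong_lie_power[OF x1 VR[OF y]] by (simp only:)
      qed
      have "commutator ?V x y \<ominus>\<^bsub>?R\<^esub> \<one>\<^bsub>?R\<^esub> = x \<otimes>\<^bsub>?R\<^esub> y \<otimes>\<^bsub>?R\<^esub> w \<ominus>\<^bsub>?R\<^esub> y \<otimes>\<^bsub>?R\<^esub> x \<otimes>\<^bsub>?R\<^esub> w"
        using yxw unfolding c by simp
      also have "\<dots> = lie ?R x y \<otimes>\<^bsub>?R\<^esub> w"
        by (rule R.minus_mult_right[symmetric]) (use VR[OF xV] VR[OF y] VR[OF w] in blast)+
      also have "\<dots> \<in> strong_lie_power ?R (Suc n)" by (rule I.I_r_closed[OF lie VR[OF w]])
      finally show ?thesis .
    qed
    then have "(\<Union>x\<in>lower_central_series ?V n. \<Union>y\<in>carrier ?V. {commutator ?V x y})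
        \<subseteq> {u \<in> carrier ?V. u \<ominus>\<^bsub>?R\<^esub> \<one>\<^bsub>?R\<^esub> \<in> strong_lie_power ?R (Suc n)}"
      using V.lcs_in_carrier by (auto simp del: normalized_units_simps group_algebra_simps strong_lie_power.simps)
    from V.generate_subgroup_incl[OF this sub] show ?case
      by (simp only: lower_central_series.simps)
  qed
  from this[of n] zero have "lower_central_series ?V n \<subseteq> {\<one>\<^bsub>?V\<^esub>}" by auto
  then have "lower_central_series ?V n = {\<one>\<^bsub>?V\<^esub>}"
    using subgroup.one_closed[OF V.lcs_subgroup] by blast
  then show ?thesis unfolding nilpotent_group_def using V.is_group by blast
qed

end

section \<open>Local nilpotency of the group of normalized units\<close>

context group
begin

lemma group_hom_subgroup_generated: "group_hom (subgroup_generated G T) G (\<lambda>x. x)"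
proof -
  have "(\<lambda>x. x) \<in> hom (subgroup_generated G T) G"
    using carrier_subgroup_generated_subset[of T] by (intro homI) auto
  then show ?thesis by (simp add: group_hom_def group_hom_axioms_def)
qed

text \<open>
  The subgroup generated by finitely many units is contained in \<open>V(FH)\<close> for the subgroup \<open>H\<close> generated
  by the supports of these units and of their inverses. The supports of the inverses are needed for
  the units to remain invertible in \<open>FH\<close>.
\<close>

lemma locally_nilpotent_normalized_units:
  assumes p: "CHAR('f::field) = p" "prime p"
    and nil: "locally_nilpotent_group G"
    and tors: "\<And>x. x \<in> derived G (carrier G) \<Longrightarrow> \<exists>m. x [^] (p ^ m :: nat) = \<one>"
  shows "locally_nilpotent_group (normalized_units G :: ('a \<Rightarrow>\<^sub>0 'f) monoid)"
  unfolding locally_nilpotent_group_def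
proof (intro conjI allI impI)
  let ?V = "normalized_units G :: ('a \<Rightarrow>\<^sub>0 'f) monoid"
  let ?R = "group_algebra G :: ('a \<Rightarrow>\<^sub>0 'f) ring"
  interpret R: ring ?R by (rule ring_group_algebra)
  interpret V: group ?V by (rule group_normalized_units)
  show "group ?V" by (rule V.is_group)
  fix S assume S: "finite S \<and> S \<subseteq> carrier ?V"
  define T where "T = (\<Union>u\<in>S. Poly_Mapping.keys u \<union> Poly_Mapping.keys (inv\<^bsub>?R\<^esub> u))"
  have T: "finite T" "T \<subseteq> carrier G"
    using S R.Units_closed R.Units_inv_closed unfolding T_def by (auto simp: subset_iff)
  let ?K = "subgroup_generated G T"
  let ?W = "normalized_units ?K :: ('a \<Rightarrow>\<^sub>0 'f) monoid"
  interpret K: group ?K by simp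
  interpret h: group_hom ?W ?V "\<lambda>u. u" by (rule group_hom_normalized_units_subgroup_generated)
  have KT: "T \<subseteq> carrier ?K" "carrier ?K = generate ?K T" using generate_subgroup_generated[OF T(2)] by auto
  obtain c where c: "lower_central_series ?K c = {\<one>\<^bsub>?K\<^esub>}"
    using nil T unfolding locally_nilpotent_group_def nilpotent_group_def by blast
  have "\<exists>m. x [^]\<^bsub>?K\<^esub> (p ^ m) = \<one>\<^bsub>?K\<^esub>" if "x \<in> lower_central_series ?K (Suc 0)" for x
    using tors lcs_hom_image[OF group_hom_subgroup_generated that]
    unfolding pow_subgroup_generated one_subgroup_generated lcs_eq_derived by blast
  from K.strong_lie_power_eventually_zero[OF p T(1) KT c this]
  have W: "nilpotent_group ?W" using K.nilpotent_normalized_units by blast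
  have "S \<subseteq> carrier ?W"
  proof
    fix u assume u: "u \<in> S"
    then have uU: "u \<in> Units ?R" and u1: "augmentation u = 1" using S by auto
    have "Poly_Mapping.keys u \<subseteq> carrier ?K" "Poly_Mapping.keys (inv\<^bsub>?R\<^esub> u) \<subseteq> carrier ?K"
      using u KT(1) unfolding T_def by blast+
    moreover have "monoid.mult (group_algebra ?K :: ('a \<Rightarrow>\<^sub>0 'f) ring) = monoid.mult ?R"
      by (simp add: group_algebra_def)
    ultimately show "u \<in> carrier ?W"
      using R.Units_l_inv[OF uU] R.Units_r_inv[OF uU]
      by (intro K.normalized_unitsI[of _ "inv\<^bsub>?R\<^esub> u"] u1) simp_all
  qed
  moreover have "subgroup (carrier ?W) ?V" using h.img_is_subgroup by simp
  ultimately have sub: "carrier (subgroup_generated ?V S) \<subseteq> carrier ?W"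
    using S V.subgroup_generated_minimal by blast
  have "(\<lambda>u. u) \<in> hom (subgroup_generated ?V S) ?W"
  proof (rule homI)
    fix u v assume "u \<in> carrier (subgroup_generated ?V S)" "v \<in> carrier (subgroup_generated ?V S)"
    then show "u \<otimes>\<^bsub>subgroup_generated ?V S\<^esub> v = u \<otimes>\<^bsub>?W\<^esub> v"
      by (simp add: group_algebra_def)
  qed (use sub in blast)
  then have "group_hom (subgroup_generated ?V S) ?W (\<lambda>u. u)"
    by (simp add: group_hom_def group_hom_axioms_def h.G.is_group del: normalized_units_simps)
  then show "nilpotent_group (subgroup_generated ?V S)"
    by (rule nilpotent_group_inj_hom[OF _ _ W]) (simp add: inj_on_def)
qed

text \<open>
  Take a nontrivial \<open>p\<close>-element \<open>z\<close> in the last term of the lower central series that contains one. A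
  commutator of \<open>z\<close> with \<open>x\<close> is the product of \<open>z\<close> and a conjugate of its inverse, hence a \<open>p\<close>-element one
  term further down, hence trivial. So \<open>z\<close> is central, and some power of it has order \<open>p\<close>.
\<close>

lemma ex_central_of_prime_order:
  assumes p: "prime p" and G: "locally_nilpotent_group G" and nil: "lower_central_series G n = {\<one>}"
    and c: "c \<in> carrier G" "ord c = p"
  shows "\<exists>z\<in>carrier G. ord z = p \<and> (\<forall>x\<in>carrier G. z \<otimes> x = x \<otimes> z)"
proof -
  define P where "P i \<longleftrightarrow> (\<exists>z\<in>lower_central_series G i. z \<noteq> \<one> \<and> (\<exists>m. z [^] (p ^ m) = \<one>))" for i
  have "c [^] (p ^ 1) = \<one>" "c \<noteq> \<one>" using c pow_ord_eq_1[of c] p by (auto simp: not_prime_1)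
  then have "P 0" unfolding P_def using c(1) by (intro bexI[of _ c] conjI exI[of _ 1]) auto
  moreover have "\<not> P n" unfolding P_def nil by blast
  ultimately obtain i where i: "P i" "\<not> P (Suc i)"
    by (induction n) auto
  then obtain z m where z: "z \<in> lower_central_series G i" "z \<noteq> \<one>" "z [^] (p ^ m) = \<one>"
    unfolding P_def by blast
  note zG = lcs_in_carrier[OF z(1)]
  have central: "z \<otimes> x = x \<otimes> z" if x: "x \<in> carrier G" for x
  proof -
    have "(x \<otimes> inv z \<otimes> inv x) [^] k = x \<otimes> inv (z [^] k) \<otimes> inv x" for k :: nat
    proof (induction k)
      case (Suc k)
      have "inv (z [^] Suc k) = inv (z [^] k) \<otimes> inv z"
        using zG by (simp add: inv_mult_group[symmetric] nat_pow_Suc2[symmetric])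
      then show ?case using Suc x zG by (simp add: m_assoc)
    qed (use x in simp)
    then have "(x \<otimes> inv z \<otimes> inv x) [^] (p ^ m) = \<one>" using z(3) x by simp
    from locally_nilpotent_pow_mult[OF G zG z(3) _ this]
    obtain l where "(z \<otimes> (x \<otimes> inv z \<otimes> inv x)) [^] (p ^ l) = \<one>" using x zG by auto
    then have "commutator G z x [^] (p ^ l) = \<one>" using x zG by (simp add: m_assoc)
    then have "commutator G z x = \<one>" using lcs_commutator[OF z(1) x] i(2) unfolding P_def by blast
    moreover have "z \<otimes> x = commutator G z x \<otimes> (x \<otimes> z)" using x zG by (simp add: m_assoc)
    ultimately show ?thesis using x zG by simp
  qed
  define l where "l = (LEAST l. z [^] (p ^ l) = \<one>)"
  have l: "z [^] (p ^ l) = \<one>" unfolding l_def using z(3) by (rule LeastI)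
  have "l \<noteq> 0" using l z(2) zG by (intro notI) simp
  then obtain j where j: "l = Suc j" using not0_implies_Suc by blast
  have nj: "z [^] (p ^ j) \<noteq> \<one>" using not_less_Least[of j "\<lambda>l. z [^] (p ^ l) = \<one>"] j unfolding l_def by simp
  have "(z [^] (p ^ j)) [^] p = \<one>" using l zG unfolding j by (simp add: nat_pow_pow mult.commute)
  then have "ord (z [^] (p ^ j)) dvd p" using zG by (simp add: pow_eq_id)
  moreover have "ord (z [^] (p ^ j)) \<noteq> 1" using nj ord_eq_1[of "z [^] (p ^ j)"] zG by auto
  ultimately have "ord (z [^] (p ^ j)) = p" using p prime_nat_iff by blast
  moreover have "z [^] (p ^ j) \<otimes> x = x \<otimes> z [^] (p ^ j)" if "x \<in> carrier G" for x
    using group_commutes_pow[of z x] central that zG by simp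
  ultimately show ?thesis using zG by blast
qed

text \<open>
  Here \<open>N\<close> is the sum of the powers of \<open>c\<close>. Since \<open>N\<close> is central and \<open>N\<^sup>2 = p N = 0\<close>, the set \<open>B = R N\<close> has
  zero multiplication, and \<open>b \<mapsto> 1 + b\<close> embeds it as an abelian group of normalized units on which \<open>g\<close>
  acts by conjugation. Nilpotency makes a power of \<open>T - 1\<close> vanish on \<open>b = h N\<close>, so \<open>T\<^sup>q b = b\<close> for
  some power \<open>q\<close> of \<open>p\<close>. Comparing supports gives that \<open>g\<^sup>q h g\<^sup>-\<^sup>q\<close> and \<open>h\<close> differ by a power of \<open>c\<close>, and
  the \<open>p\<close>-th power of that difference is trivial.
\<close>

lemma central_p_element_prime_power_commutes:
  assumes p: "CHAR('f::field) = p" "prime p"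
    and V: "locally_nilpotent_group (normalized_units G :: ('a \<Rightarrow>\<^sub>0 'f) monoid)"
    and c: "c \<in> carrier G" "ord c = p" and central: "\<And>x. x \<in> carrier G \<Longrightarrow> c \<otimes> x = x \<otimes> c"
    and g: "g \<in> carrier G" and h: "h \<in> carrier G"
  shows "\<exists>m. g [^] (p ^ m :: nat) \<otimes> h = h \<otimes> g [^] (p ^ m)"
proof -
  let ?R = "group_algebra G :: ('a \<Rightarrow>\<^sub>0 'f) ring"
  let ?V = "normalized_units G :: ('a \<Rightarrow>\<^sub>0 'f) monoid"
  interpret R: ring ?R by (rule ring_group_algebra)
  interpret V: group ?V by (rule group_normalized_units)
  let ?m = "\<lambda>a b. a \<otimes>\<^bsub>?R\<^esub> b"
  have sum_mult: "?m a (\<Sum>i\<in>A. f i) = (\<Sum>i\<in>A. ?m a (f i))" "?m (\<Sum>i\<in>A. f i) a = (\<Sum>i\<in>A. ?m (f i) a)"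
    for a and f :: "nat \<Rightarrow> _" and A
    by (induction A rule: infinite_finite_induct) (simp_all add: group_algebra_distrib)
  note mc = group_algebra_mult_closed and ma = group_algebra_assoc
  have cp: "c [^] p = \<one>" using c pow_ord_eq_1[of c] by simp
  define N :: "'a \<Rightarrow>\<^sub>0 'f" where "N = (\<Sum>i<p. basis (c [^] i))"
  have Nk: "Poly_Mapping.keys N \<subseteq> carrier G"
    unfolding N_def using c by (intro order_trans[OF keys_sum]) auto
  have cN: "?m (basis c) N = N"
  proof -
    have "?m (basis c) N = (\<Sum>i<p. basis (c [^] Suc i))"
      unfolding N_def sum_mult nat_pow_Suc2[OF c(1)] by simp
    also have "\<dots> = N"
      using sum.lessThan_Suc_shift[of "\<lambda>i. basis (c [^] i) :: 'a \<Rightarrow>\<^sub>0 'f" p] cp unfolding N_def by simp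
    finally show ?thesis .
  qed
  have ciN: "?m (basis (c [^] i)) N = N" for i :: nat
  proof (induction i)
    case (Suc i)
    have "?m (basis (c [^] Suc i)) N = ?m (?m (basis (c [^] i)) (basis c)) N" by simp
    also have "\<dots> = N" using Suc cN c(1) Nk by (subst ma) auto
    finally show ?case .
  qed (use Nk in \<open>simp add: group_algebra_one\<close>)
  have NN: "?m N N = 0"
  proof -
    have "?m N N = (\<Sum>i<p. N)"
      by (subst (1) N_def) (simp only: sum_mult ciN)
    moreover have "(of_nat p :: 'f) = 0" using p(1) of_nat_CHAR[where ?'a = 'f] by simp
    ultimately show ?thesis by (intro poly_mapping_eqI) (simp add: lookup_sum)
  qed
  have augN: "augmentation N = 0"
  proof -
    have "augmentation (\<Sum>i<n. basis (c [^] i) :: 'a \<Rightarrow>\<^sub>0 'f) = of_nat n" for n :: nat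
      by (induction n) (simp_all add: augmentation_add augmentation_def[of 0])
    then show ?thesis unfolding N_def using p(1) of_nat_CHAR[where ?'a = 'f] by simp
  qed
  have Ncomm: "?m N a = ?m a N" if "Poly_Mapping.keys a \<subseteq> carrier G" for a
    using that
  proof (induction a rule: keys_subset_induct)
    case (single x d)
    have "c [^] i \<otimes> x = x \<otimes> c [^] i" for i :: nat
      using group_commutes_pow[of c x] central single c by simp
    then show ?case unfolding N_def sum_mult by simp
  qed (simp_all add: group_algebra_distrib)
  define B where "B = {?m a N | a. Poly_Mapping.keys a \<subseteq> carrier G}"
  have Bk: "Poly_Mapping.keys b \<subseteq> carrier G" if "b \<in> B" for b
    using that mc Nk unfolding B_def by blast
  have BB: "?m b b' = 0" if bb: "b \<in> B" "b' \<in> B" for b b'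
  proof -
    obtain a a' where a: "b = ?m a N" "b' = ?m a' N" "Poly_Mapping.keys a \<subseteq> carrier G" "Poly_Mapping.keys a' \<subseteq> carrier G"
      using bb unfolding B_def by blast
    have "?m b b' = ?m a (?m (?m N a') N)" unfolding a(1,2) using a(3,4) Nk by (simp add: ma mc)
    also have "?m (?m N a') N = ?m a' (?m N N)"
      unfolding Ncomm[OF a(4)] by (rule ma[OF a(4) Nk Nk])
    finally show ?thesis by (simp add: NN)
  qed
  have Bdiff: "b - b' \<in> B" if bb: "b \<in> B" "b' \<in> B" for b b'
  proof -
    obtain a a' where a: "b = ?m a N" "b' = ?m a' N" "Poly_Mapping.keys a \<subseteq> carrier G" "Poly_Mapping.keys a' \<subseteq> carrier G"
      using bb unfolding B_def by blast
    have "b - b' = ?m (a - a') N" unfolding a(1,2) by (simp add: group_algebra_diff_distrib)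
    moreover have "Poly_Mapping.keys (a - a') \<subseteq> carrier G" using a keys_diff[of a a'] by blast
    ultimately show ?thesis unfolding B_def by blast
  qed
  let ?T = "\<lambda>v. ?m (?m (basis g) v) (basis (inv g))"
  have TB: "?T b \<in> B" if bb: "b \<in> B" for b
  proof -
    obtain a where a: "b = ?m a N" "Poly_Mapping.keys a \<subseteq> carrier G" using bb unfolding B_def by blast
    have "?T b = ?m (?T a) N" unfolding a(1) using a(2) g Nk Ncomm[of "basis (inv g)"] by (simp add: ma mc)
    moreover have "Poly_Mapping.keys (?T a) \<subseteq> carrier G" using a(2) g by (simp add: mc)
    ultimately show ?thesis unfolding B_def by blast
  qed
  have unit: "?m (basis \<one> + b) (basis \<one> - b) = basis \<one>" "?m (basis \<one> - b) (basis \<one> + b) = basis \<one>"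
    "basis \<one> + b \<in> carrier ?V" if b: "b \<in> B" for b
  proof -
    show 1: "?m (basis \<one> + b) (basis \<one> - b) = basis \<one>" "?m (basis \<one> - b) (basis \<one> + b) = basis \<one>"
      using BB[OF b b] Bk[OF b]
      by (simp_all add: group_algebra_distrib group_algebra_diff_distrib group_algebra_one)
    have "augmentation b = 0" using b augN unfolding B_def by (auto simp: augmentation_mult)
    moreover have "Poly_Mapping.keys (basis \<one> - b) \<subseteq> carrier G" "Poly_Mapping.keys (basis \<one> + b) \<subseteq> carrier G"
      using Bk[OF b] keys_diff[of "basis \<one>" b] keys_add[of "basis \<one>" b] by auto
    ultimately show "basis \<one> + b \<in> carrier ?V"
      using 1 by (intro normalized_unitsI[of _ "basis \<one> - b"]) (simp_all add: augmentation_add)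
  qed
  have Binv: "inv\<^bsub>?V\<^esub> (basis \<one> + b) = basis \<one> - b" "basis \<one> - b \<in> carrier ?V"
    "inv\<^bsub>?V\<^esub> (basis \<one> - b) = basis \<one> + b" if b: "b \<in> B" for b
  proof -
    have "- b \<in> B" using Bdiff[OF Bdiff[OF b b] b] by simp
    from unit(3)[OF this] show m: "basis \<one> - b \<in> carrier ?V" by simp
    show "inv\<^bsub>?V\<^esub> (basis \<one> + b) = basis \<one> - b"
      by (rule V.inv_equality) (use unit[OF b] m in \<open>simp_all only: normalized_units_simps\<close>)
    show "inv\<^bsub>?V\<^esub> (basis \<one> - b) = basis \<one> + b"
      by (rule V.inv_equality) (use unit[OF b] m in \<open>simp_all only: normalized_units_simps\<close>)
  qed
  note basis_closed = group_hom.hom_closed[OF group_hom_basis]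
    and basis_inv = group_hom.hom_inv[OF group_hom_basis]
  define b where "b = ?m (basis h) N"
  have b: "b \<in> B" unfolding b_def B_def using h by auto
  let ?D = "\<lambda>v. ?T v - v"
  have comm: "?m (?m (?m (basis \<one> - v) (basis g)) (basis \<one> + v)) (basis (inv g)) = basis \<one> + ?D v"
    if v: "v \<in> B" for v
  proof -
    have k: "Poly_Mapping.keys (basis \<one> - v) \<subseteq> carrier G" "Poly_Mapping.keys (basis \<one> + v) \<subseteq> carrier G"
      using Bk[OF v] keys_diff[of "basis \<one>" v] keys_add[of "basis \<one>" v] by auto
    have "?m (?m (?m (basis \<one> - v) (basis g)) (basis \<one> + v)) (basis (inv g))
        = ?m (basis \<one> - v) (?T (basis \<one> + v))"
      using g k by (simp add: ma mc)
    also have "?T (basis \<one> + v) = basis \<one> + ?T v" using g by (simp add: group_algebra_distrib)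
    also have "?m (basis \<one> - v) (basis \<one> + ?T v) = basis \<one> + ?D v"
      using BB[OF v TB[OF v]] Bk[OF v] Bk[OF TB[OF v]]
      by (simp add: group_algebra_distrib group_algebra_diff_distrib group_algebra_one)
    finally show ?thesis .
  qed
  let ?W = "subgroup_generated ?V {basis \<one> + b, basis g}"
  interpret W: group ?W by (rule V.group_subgroup_generated)
  have gens: "{basis \<one> + b, basis g} \<subseteq> carrier ?V"
    unfolding insert_subset by (intro conjI empty_subsetI unit(3) b basis_closed g)
  have gW: "basis \<one> + b \<in> carrier ?W" "basis g \<in> carrier ?W"
    using V.generate_subgroup_generated(1)[OF gens] by (simp_all only: insert_subset)
  have "nilpotent_group ?W"
    using V gens unfolding locally_nilpotent_group_def
    by (simp only: finite.emptyI finite.insertI simp_thms)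
  then obtain n where n: "lower_central_series ?W n = {\<one>\<^bsub>?W\<^esub>}"
    unfolding nilpotent_group_def by blast
  \<comment> \<open>The commutator with \<open>g\<close> is formed from the inverse \<open>1 - v\<close> of \<open>1 + v\<close>; this way the next
    element is \<open>1 + (T - 1) v\<close> and not \<open>1 - (T - 1) v\<close>.\<close>
  have iter: "(?D ^^ i) b \<in> B \<and> basis \<one> + (?D ^^ i) b \<in> lower_central_series ?W i" for i
  proof (induction i)
    case 0
    show ?case by (simp only: funpow_0 lower_central_series.simps(1) b gW simp_thms)
  next
    case (Suc i)
    define v where "v = (?D ^^ i) b"
    have v: "v \<in> B" "basis \<one> + v \<in> lower_central_series ?W i" using Suc unfolding v_def by (simp_all only:)
    have vW: "basis \<one> + v \<in> carrier ?W" using v(2) by (rule W.lcs_in_carrier)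
    have "inv\<^bsub>?W\<^esub> (basis \<one> + v) \<in> lower_central_series ?W i"
      by (rule subgroup.m_inv_closed[OF W.lcs_subgroup v(2)])
    then have v2: "basis \<one> - v \<in> lower_central_series ?W i"
      unfolding V.inv_subgroup_generated[OF vW] Binv(1)[OF v(1)] .
    then have v2W: "basis \<one> - v \<in> carrier ?W" by (rule W.lcs_in_carrier)
    have "commutator ?W (basis \<one> - v) (basis g) \<in> lower_central_series ?W (Suc i)"
      by (rule W.lcs_commutator[OF v2 gW(2)])
    also have "commutator ?W (basis \<one> - v) (basis g)
        = ?m (?m (?m (basis \<one> - v) (basis g)) (basis \<one> + v)) (basis (inv g))"
      unfolding V.inv_subgroup_generated[OF v2W] V.inv_subgroup_generated[OF gW(2)] Binv(3)[OF v(1)]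
        basis_inv[OF g, symmetric] by (simp only: mult_subgroup_generated normalized_units_simps)
    also have "\<dots> = basis \<one> + ?D v" by (rule comm[OF v(1)])
    finally show ?case using Bdiff[OF TB[OF v(1)] v(1)]
      by (simp only: v_def funpow.simps(2) o_apply simp_thms)
  qed
  have "(?D ^^ n) b = 0" using iter[of n] unfolding n by simp
  moreover have "?D 0 = 0" by simp
  then have "(?D ^^ k) 0 = 0" for k by (induction k) simp_all
  ultimately have Dk: "(?D ^^ (k + n)) b = 0" for k by (simp add: funpow_add)
  have "n \<le> p ^ n" using power_gt_expt[of p n] prime_gt_1_nat[OF p(2)] by simp
  then have "(?D ^^ (p ^ n)) b = 0" using Dk[of "p ^ n - n"] by (simp only: le_add_diff_inverse2)
  then have fix_b: "(?T ^^ (p ^ n)) b = b"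
    using additive_minus_id_prime_power[OF _ p, of ?T n b] by (simp add: group_algebra_diff_distrib)
  have Tpow: "(?T ^^ k) b = ?m (basis (g [^] k \<otimes> h \<otimes> inv (g [^] k))) N" for k :: nat
  proof (induction k)
    case 0
    then show ?case using h by (simp add: b_def)
  next
    case (Suc k)
    let ?x = "g [^] k \<otimes> h \<otimes> inv (g [^] k)"
    have x: "?x \<in> carrier G" using g h by simp
    have "(?T ^^ Suc k) b = ?m (?T (basis ?x)) N"
      using Suc g x Nk Ncomm[of "basis (inv g)"] by (simp add: ma mc del: group_algebra_mult_single)
    also have "?T (basis ?x) = basis (g \<otimes> ?x \<otimes> inv g)" by simp
    also have "g \<otimes> ?x \<otimes> inv g = g [^] Suc k \<otimes> h \<otimes> inv (g [^] Suc k)"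
      unfolding nat_pow_Suc2[OF g] using g h by (simp add: m_assoc inv_mult_group)
    finally show ?case .
  qed
  define q where "q = p ^ n"
  define k where "k = g [^] q \<otimes> h \<otimes> inv (g [^] q)"
  have kG: "k \<in> carrier G" unfolding k_def using g h by simp
  have eq: "?m (basis k) N = ?m (basis h) N" using Tpow[of q] fix_b unfolding k_def q_def b_def by simp
  \<comment> \<open>The coefficient at \<open>h\<close> vanishes unless \<open>h\<close> lies in the coset of \<open>x\<close> modulo the powers of \<open>c\<close>;
    for \<open>x = h\<close> it is \<open>1\<close>.\<close>
  have coeff: "Poly_Mapping.lookup (?m (basis x) N) h = of_nat (card {i. i < p \<and> x \<otimes> c [^] i = h})" if "x \<in> carrier G" for x
    unfolding N_def sum_mult by (simp add: lookup_sum lookup_single when_def sum.If_cases Int_def conj_commute)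
  have "{i. i < p \<and> h \<otimes> c [^] i = h} = {0}"
    using p(2) h c by (auto simp: pow_eq_id prime_gt_0_nat dest: nat_dvd_not_less)
  then have "Poly_Mapping.lookup (?m (basis k) N) h = 1" unfolding eq coeff[OF h] by simp
  then have "{i. i < p \<and> k \<otimes> c [^] i = h} \<noteq> {}" unfolding coeff[OF kG] by (metis card.empty of_nat_0 zero_neq_one)
  then obtain i :: nat where i: "k \<otimes> c [^] i = h" by blast
  define w where "w = c [^] i"
  have w: "w \<in> carrier G" unfolding w_def using c by simp
  have "w [^] p = (c [^] p) [^] i" unfolding w_def using c by (simp add: nat_pow_pow mult.commute)
  then have wp: "w [^] p = \<one>" using cp by simp
  have wc: "w \<otimes> x = x \<otimes> w" if "x \<in> carrier G" for x
    unfolding w_def using group_commutes_pow[of c x] central that c by simp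
  have v: "g [^] q \<in> carrier G" using g by simp
  have "h \<otimes> g [^] q = w \<otimes> (k \<otimes> g [^] q)"
    using i wc[OF kG] kG w v unfolding w_def[symmetric] by (simp flip: m_assoc)
  also have "k \<otimes> g [^] q = g [^] q \<otimes> h" unfolding k_def using g h by (simp add: m_assoc)
  finally have "h \<otimes> (g [^] q) [^] p = w [^] p \<otimes> ((g [^] q) [^] p \<otimes> h)"
    by (intro commute_past_pow h v w wc)
  then have "h \<otimes> g [^] (p ^ Suc n) = g [^] (p ^ Suc n) \<otimes> h"
    using wp g h unfolding q_def by (simp add: nat_pow_pow mult.commute)
  then show ?thesis by metis
qed

text \<open>
  If some \<open>p\<close>-power of \<open>s\<close> commutes with a given element, then so do all higher ones. Hence a single
  exponent serves for finitely many generators, and the resulting power is central.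
\<close>

lemma finite_generators_prime_power_central:
  assumes S: "finite S" "S \<subseteq> carrier G" "carrier G = generate G S"
    and comm: "\<And>x y. \<lbrakk>x \<in> carrier G; y \<in> carrier G\<rbrakk> \<Longrightarrow> \<exists>m. x [^] (p ^ m :: nat) \<otimes> y = y \<otimes> x [^] (p ^ m)"
    and s: "s \<in> carrier G"
  shows "\<exists>m. \<forall>x\<in>carrier G. commutator G x (s [^] (p ^ m :: nat)) = \<one>"
proof -
  have "\<exists>m. \<forall>t\<in>F. s [^] (p ^ m) \<otimes> t = t \<otimes> s [^] (p ^ m)" if "finite F" "F \<subseteq> carrier G" for F
    using that
  proof (induction F)
    case (insert t F)
    have up: "s [^] (p ^ (i + j)) \<otimes> u = u \<otimes> s [^] (p ^ (i + j))"
      if "s [^] (p ^ i) \<otimes> u = u \<otimes> s [^] (p ^ i)" "u \<in> carrier G" for u i j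
      using group_commutes_pow[of "s [^] (p ^ i)" u "p ^ j"] that s by (simp add: nat_pow_pow power_add)
    obtain i where i: "\<forall>t\<in>F. s [^] (p ^ i) \<otimes> t = t \<otimes> s [^] (p ^ i)" using insert by blast
    obtain j where j: "s [^] (p ^ j) \<otimes> t = t \<otimes> s [^] (p ^ j)" using comm[OF s] insert by blast
    have "s [^] (p ^ (i + j)) \<otimes> t = t \<otimes> s [^] (p ^ (i + j))"
      using up[OF j, of i] insert.prems by (simp add: add.commute)
    then have "\<forall>u\<in>insert t F. s [^] (p ^ (i + j)) \<otimes> u = u \<otimes> s [^] (p ^ (i + j))"
      using i up[of i _ j] insert.prems by blast
    then show ?case by blast
  qed simp
  from this[OF S(1,2)] obtain m where m: "\<forall>t\<in>S. s [^] (p ^ m) \<otimes> t = t \<otimes> s [^] (p ^ m)" by blast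
  let ?u = "s [^] (p ^ m)"
  have u: "?u \<in> carrier G" using s by simp
  have "?u \<otimes> x = x \<otimes> ?u" if "x \<in> generate G S" for x
    using that
  proof (induction x rule: generate.induct)
    case (incl t)
    then show ?case using m by blast
  next
    case (inv t)
    then show ?case using m S(2) commute_inv[OF u] by blast
  next
    case (eng x y)
    then show ?case using S(2) commute_mult[OF u] generate_in_carrier by blast
  qed (use u in simp)
  then have "commutator G x ?u = \<one>" if "x \<in> carrier G" for x
    using that u S(3) by (metis (no_types, lifting) inv_closed m_assoc m_closed r_inv r_one)
  then show ?thesis by blast
qed

lemma normalized_units_locally_nilpotent_imp:
  assumes "locally_nilpotent_group (normalized_units G :: ('a \<Rightarrow>\<^sub>0 'f::field) monoid)"
  shows "locally_nilpotent_group G"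
    and "locally_nilpotent_group (normalized_units (subgroup_generated G T) :: ('a \<Rightarrow>\<^sub>0 'f) monoid)"
  using locally_nilpotent_group_inj_hom[OF group_hom_basis inj_basis assms]
    locally_nilpotent_group_inj_hom[OF group_hom_normalized_units_subgroup_generated _ assms]
  by (simp_all add: inj_on_def)

text \<open>
  The element \<open>c\<close> is adjoined to \<open>g\<close> and \<open>h\<close> only to provide a central element of order \<open>p\<close> in a finitely
  generated, and therefore nilpotent, group.
\<close>

lemma commutator_prime_power:
  assumes p: "CHAR('f::field) = p" "prime p"
    and V: "locally_nilpotent_group (normalized_units G :: ('a \<Rightarrow>\<^sub>0 'f) monoid)"
    and c: "c \<in> carrier G" "ord c = p" and g: "g \<in> carrier G" and h: "h \<in> carrier G"
  shows "\<exists>m. commutator G g h [^] (p ^ m :: nat) = \<one>"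
proof -
  let ?T = "{g, h, c}"
  let ?K = "subgroup_generated G ?T"
  interpret K: group ?K by simp
  have T: "finite ?T" "?T \<subseteq> carrier G" using c g h by auto
  have KT: "?T \<subseteq> carrier ?K" "carrier ?K = generate ?K ?T" using generate_subgroup_generated[OF T(2)] by auto
  note VK = normalized_units_locally_nilpotent_imp(2)[OF V, of ?T]
  note K = K.normalized_units_locally_nilpotent_imp(1)[OF VK]
  obtain n where n: "lower_central_series ?K n = {\<one>\<^bsub>?K\<^esub>}"
    using normalized_units_locally_nilpotent_imp(1)[OF V] T
    unfolding locally_nilpotent_group_def nilpotent_group_def by blast
  have "K.ord c = ord c" by (simp add: ord_def K.ord_def pow_subgroup_generated)
  then have "K.ord c = p" using c by simp
  from K.ex_central_of_prime_order[OF p(2) K n _ this]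
  obtain z where z: "z \<in> carrier ?K" "K.ord z = p" "\<And>x. x \<in> carrier ?K \<Longrightarrow> z \<otimes>\<^bsub>?K\<^esub> x = x \<otimes>\<^bsub>?K\<^esub> z"
    using KT(1) by blast
  note K.central_p_element_prime_power_commutes[OF p VK z]
  note K.finite_generators_prime_power_central[OF T(1) KT this]
  note K.nilpotent_derived_pow[OF n KT this]
  moreover have "commutator ?K g h \<in> lower_central_series ?K (Suc 0)"
    using KT(1) by (intro K.lcs_commutator) auto
  moreover have "commutator ?K g h = commutator G g h" using KT(1) by simp
  ultimately show ?thesis using KT(1) by (auto simp: pow_subgroup_generated)
qed

lemma derived_prime_power:
  assumes nil: "locally_nilpotent_group G"
    and comm: "\<And>g h. \<lbrakk>g \<in> carrier G; h \<in> carrier G\<rbrakk> \<Longrightarrow> \<exists>m. commutator G g h [^] (p ^ m :: nat) = \<one>"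
    and x: "x \<in> derived G (carrier G)"
  shows "\<exists>m. x [^] (p ^ m :: nat) = \<one>"
  using x unfolding derived_def
proof (induction x rule: generate.induct)
  case one
  then show ?case by simp
next
  case (incl x)
  then show ?case using comm by blast
next
  case (inv x)
  then obtain m where "x [^] (p ^ m) = \<one>" "x \<in> carrier G" using comm by blast
  then show ?case by (auto simp: nat_pow_inv intro!: exI[of _ m])
next
  case (eng x y)
  have "derived_set G (carrier G) \<subseteq> carrier G" by (rule derived_set_in_carrier) simp
  then have xy: "x \<in> carrier G" "y \<in> carrier G" using eng(1,2) generate_in_carrier by blast+
  obtain i j where "x [^] (p ^ i) = \<one>" "y [^] (p ^ j) = \<one>" using eng(3,4) by blast
  then show ?case using locally_nilpotent_pow_mult[OF nil] xy by blast
qed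

lemma p_group_subgroup_iff:
  assumes p: "prime p" and H: "subgroup H G"
  shows "p_group p (G\<lparr>carrier := H\<rparr>) \<longleftrightarrow> (\<forall>x\<in>H. \<exists>m. x [^] (p ^ m :: nat) = \<one>)"
proof -
  interpret H: group "G\<lparr>carrier := H\<rparr>" by (rule subgroup_imp_group[OF H])
  have "(\<exists>k. H.ord x = p ^ k) \<longleftrightarrow> (\<exists>m. x [^] (p ^ m :: nat) = \<one>)" if "x \<in> H" for x
  proof -
    have "x [^] n = \<one> \<longleftrightarrow> H.ord x dvd n" for n :: nat
      using H.pow_eq_id[of x n] that nat_pow_consistent[of x n H] by simp
    then show ?thesis using divides_primepow_nat[OF p] by blast
  qed
  then show ?thesis unfolding p_group_def using H.is_group by simp
qed

end

theorem theorem3: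
  fixes G :: "('g, 'm) monoid_scheme" and p :: nat
  assumes "group G"
    and "CHAR('f::field) = p" and "p > 0"
    and "\<exists>x\<in>carrier G. group.ord G x = p"
  shows "locally_nilpotent_group (normalized_units G :: ('g \<Rightarrow>\<^sub>0 'f) monoid) \<longleftrightarrow>
    locally_nilpotent_group G \<and> p_group p (G\<lparr>carrier := derived G (carrier G)\<rparr>)"
proof -
  interpret group G by fact
  have p: "prime p" using prime_CHAR_semidom[where ?'a = 'f] assms(2,3) by simp
  have pG: "p_group p (G\<lparr>carrier := derived G (carrier G)\<rparr>)
      \<longleftrightarrow> (\<forall>x\<in>derived G (carrier G). \<exists>m. x [^]\<^bsub>G\<^esub> (p ^ m :: nat) = \<one>\<^bsub>G\<^esub>)"
    by (rule p_group_subgroup_iff[OF p derived_is_subgroup]) simp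
  obtain c where c: "c \<in> carrier G" "ord c = p" using assms(4) by blast
  show ?thesis
  proof
    assume V: "locally_nilpotent_group (normalized_units G :: ('g \<Rightarrow>\<^sub>0 'f) monoid)"
    note nil = normalized_units_locally_nilpotent_imp(1)[OF V]
    show "locally_nilpotent_group G \<and> p_group p (G\<lparr>carrier := derived G (carrier G)\<rparr>)"
      unfolding pG using nil derived_prime_power[OF nil commutator_prime_power[OF assms(2) p V c]] by blast
  next
    assume "locally_nilpotent_group G \<and> p_group p (G\<lparr>carrier := derived G (carrier G)\<rparr>)"
    then show "locally_nilpotent_group (normalized_units G :: ('g \<Rightarrow>\<^sub>0 'f) monoid)"
      unfolding pG by (intro locally_nilpotent_normalized_units[OF assms(2) p]) blast+
  qed
qed

end
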